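(* Suppose that the one-dimensional steady boundary value problem $$f(U)_x = a(U,x)\ \ (x_L<x<x_R),\qquad U(x_L)=U_L^{\alpha_1,\ldots,\alpha_I}\ \text{for some } (\alpha_1,\ldots,\alpha_I),\qquad B_R(U(x_R))=0$$ is well-posed in the sense of assumptions (A1)--(A4) given in the context. Suppose also that the discrete operators $\mathcal{P}^h,\Phi^h$ are based upon consistent and stable approximations of the initial value problems $f(U)_x=a(U,x)$ on $x_1<x<x_2$, $U(x_1)=U_0$, are Lipschitz in the unknowns $y=(\alpha_1,\ldots,\alpha_I,x_S)$, and approximate the continuous operators $\mathcal{P},\Phi$ with accuracy on the order of $h^k$. Then there is an open set $Y\subset\mathbb{R}^{I+1}$ containing $y^{ex}$, independent of $h$, and a constant $C$ independent of $h$, such that any solution $y^h_*\in Y$ of the discrete problem $$\mathcal{G}^h(y)\equiv B_R\big(\mathcal{P}^h_{x_Sx_R}\Phi^h\mathcal{P}^h_{x_Lx_S}U_L^{\alpha_1,\ldots,\alpha_I}\big)=0$$ satisfies $$\|y^h_*-y^{ex}\|\le Ch^k.$$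
   Context: Setting. $U:[x_L,x_R]\to\mathbb{R}^n$ is the unknown of the steady state of the hyperbolic system $U_t+f(U)_x=a(U,x)$; the Jacobian $\nabla f(U)$ has real distinct eigenvalues $\lambda_1<\cdots<\lambda_n$. At $x=x_L$ exactly the first $I$ eigenvalues are negative and the others positive; at $x=x_R$ exactly the first $J$ eigenvalues are negative and the others positive. The left boundary condition determines $n-I$ components of $U(x_L)$, leaving $I$ degrees of freedom in the form of unknown parameters $\alpha_1,\ldots,\alpha_I$ (the undetermined components); the resulting family of left boundary states is written $U_L^{\alpha_1,\ldots,\alpha_I}$. The right boundary condition consists of $J$ scalar equations $B_R(U)=(B_R^1(U),\ldots,B_R^J(U))=0$. The case considered is that of a solution consisting of a single Lax shock and no turning (sonic) points (no eigenvalue vanishes along the smooth parts), so that $J=I+1$. Lax shock. A stationary shock in the $j$-th characteristic field with left state $U_-$ and right state $U_+$ is a discontinuity satisfying the Rankine-Hugoniot condition $f(U_+)=f(U_-)$ and the Lax entropy conditions $\lambda_j(U_+)<0<\lambda_j(U_-)$ and $\lambda_{j-1}(U_-)<0<\lambda_{j+1}(U_+)$ (conditions with indices outside $1,\ldots,n$ are omitted). Well-posedness. The boundary value problem is called well-posed if: (A1) It has a unique solution $U^{ex}$ (with left parameters $\alpha_1^{ex},\ldots,\alpha_I^{ex}$), which consists of two smooth ($C^1$) states separated by a Lax shock at the location $x_S^{ex}$. This solution is stable in $L^1$ under perturbations of the data. (Reading: for data perturbed slightly, e.g. $B_R(U)=b$ with $b$ near $0$, there is again a unique solution of this form, and the $L^1(x_L,x_R)$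 distance between two such solutions is at most a constant times the difference of the data.) (A2) For each $x\in[x_L,x_R]$, the flux $f(U)$ is a $C^{1,1}$ diffeomorphism near $U^{ex}(x)$ and the source term $a(U,x)$ is Lipschitz near $(U^{ex}(x),x)$ (at $x=x_S^{ex}$ both one-sided values are meant). This ensures that the ODEs satisfied by each smooth solution component are well-posed. (A3) There is a unique entropy-satisfying solution $\Phi U^{ex}(x_S)$ of the Rankine-Hugoniot condition $f(\Phi U^{ex}(x_S))=f(U^{ex}(x_S))$, where $x_S=x_S^{ex}$ and $U^{ex}(x_S)$ is the state on the left of the shock, so that the jump operator $\Phi$ is well-defined near $U^{ex}(x_S)$. (A4) The functions $U_L^{\alpha_1,\ldots,\alpha_I}$ and $B_R(U)$ are Lipschitz near $(\alpha_1^{ex},\ldots,\alpha_I^{ex})$ and $U^{ex}(x_R)$ respectively. Operators. $\mathcal{P}_{x_1x_2}U_0:=U(x_2)$, where $U$ solves $f(U)_x=a(U,x)$ for $x_1<x<x_2$ with $U(x_1)=U_0$. The jump operator $\Phi$ maps a left state $U_-$ to a state $\Phi U_-$ (a right state, different from $U_-$) with $f(\Phi U_-)=f(U_-)$ and satisfying the Lax entropy conditions. The unknowns are collected in $y=(\alpha_1,\ldots,\alpha_I,x_S)\in\mathbb{R}^{I+1}$, and $\mathcal{G}(y)\equiv B_R\big(\mathcal{P}_{x_Sx_R}\Phi\mathcal{P}_{x_Lx_S}U_L^{\alpha_1,\ldots,\alpha_I}\big)$; the exact parameter vector $y^{ex}=(\alpha_1^{ex},\ldots,\alpha_I^{ex},x_S^{ex})$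 satisfies $\mathcal{G}(y^{ex})=0$. $\mathcal{P}^h$ and $\Phi^h$ denote discrete approximations, with discretization parameter $h>0$, of $\mathcal{P}$ and $\Phi$; $\mathcal{G}^h$ is obtained from $\mathcal{G}$ by replacing $\mathcal{P},\Phi$ by $\mathcal{P}^h,\Phi^h$. Accuracy of order $h^k$ means errors bounded by a constant times $h^k$, uniformly for arguments near those of the exact solution. *)

theory Defs
  imports "HOL-Analysis.Analysis"
begin

section \<open>Local regularity\<close>

definition lipschitz_near ::
  "'a::metric_space set \<Rightarrow> ('a \<Rightarrow> 'b::metric_space) \<Rightarrow> 'a \<Rightarrow> bool" where
  "lipschitz_near S g z \<longleftrightarrow> (\<exists>r>0. \<exists>L. L-lipschitz_on (ball z r \<inter> S) g)"

definition C11_on ::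
  "('a::real_normed_vector \<Rightarrow> 'b::real_normed_vector) \<Rightarrow> 'a set \<Rightarrow> bool" where
  "C11_on g N \<longleftrightarrow>
     (\<exists>g' L. (\<forall>z\<in>N. (g has_derivative blinfun_apply (g' z)) (at z)) \<and> L-lipschitz_on N g')"

definition C11_diffeo_near ::
  "('a::real_normed_vector \<Rightarrow> 'b::real_normed_vector) \<Rightarrow> 'a \<Rightarrow> bool" where
  "C11_diffeo_near g z \<longleftrightarrow>
     (\<exists>N k. open N \<and> z \<in> N \<and> open (g ` N) \<and> (\<forall>w\<in>N. k (g w) = w) \<and>
            C11_on g N \<and> C11_on k (g ` N))"


section \<open>Hyperbolicity and Lax shocks\<close>

definition is_eigenvalue :: "real^'n^'n \<Rightarrow> real \<Rightarrow> bool" where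
  "is_eigenvalue A c \<longleftrightarrow> (\<exists>v. v \<noteq> 0 \<and> A *v v = c *\<^sub>R v)"

text \<open>Throughout, \<open>D\<close> is the open state space and \<open>lam i U\<close>, for \<open>1 \<le> i \<le> n\<close> with
  \<open>n = CARD('n)\<close>, is the \<open>i\<close>-th smallest eigenvalue of the Jacobian of \<open>f\<close> at \<open>U\<close>.
  Being \<open>n\<close> distinct eigenvalues, these are all of them.\<close>

definition strictly_hyperbolic ::
  "(real^'n) set \<Rightarrow> (real^'n \<Rightarrow> real^'n) \<Rightarrow> (nat \<Rightarrow> real^'n \<Rightarrow> real) \<Rightarrow> bool" where
  "strictly_hyperbolic D f lam \<longleftrightarrow>
     (\<forall>U\<in>D. f differentiable (at U) \<and>
        (\<forall>i\<in>{1..CARD('n)}. is_eigenvalue (jacobian f (at U)) (lam i U)) \<and>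
        (\<forall>i\<in>{1..<CARD('n)}. lam i U < lam (i + 1) U))"

definition first_negative :: "(nat \<Rightarrow> real^'n \<Rightarrow> real) \<Rightarrow> nat \<Rightarrow> real^'n \<Rightarrow> bool" where
  "first_negative lam m U \<longleftrightarrow>
     (\<forall>i\<in>{1..CARD('n)}. (i \<le> m \<longrightarrow> lam i U < 0) \<and> (m < i \<longrightarrow> 0 < lam i U))"

definition lax_shock ::
  "(real^'n) set \<Rightarrow> (real^'n \<Rightarrow> real^'n) \<Rightarrow> (nat \<Rightarrow> real^'n \<Rightarrow> real) \<Rightarrow>
   real^'n \<Rightarrow> real^'n \<Rightarrow> bool" where
  "lax_shock D f lam Um Up \<longleftrightarrow>
     Um \<in> D \<and> Up \<in> D \<and> Up \<noteq> Um \<and> f Up = f Um \<and>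
     (\<exists>j\<in>{1..CARD('n)}.
        lam j Up < 0 \<and> 0 < lam j Um \<and>
        (1 < j \<longrightarrow> lam (j - 1) Um < 0) \<and>
        (j < CARD('n) \<longrightarrow> 0 < lam (j + 1) Up))"

text \<open>Uniqueness of the shock partner of the single state \<open>U0\<close> does not exclude that nearby left
  states have further, remote partners. The jump operator near \<open>U0\<close> is therefore the branch of
  partners lying in some neighbourhood \<open>W\<close> of \<open>Phi U0\<close>; the choice \<open>W = UNIV\<close> covers the case of
  a globally unique partner.\<close>

definition jump_operator_near ::
  "(real^'n) set \<Rightarrow> (real^'n \<Rightarrow> real^'n) \<Rightarrow> (nat \<Rightarrow> real^'n \<Rightarrow> real) \<Rightarrow>
   (real^'n \<Rightarrow> real^'n) \<Rightarrow> real^'n \<Rightarrow> bool" where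
  "jump_operator_near D f lam Phi U0 \<longleftrightarrow>
     (\<exists>N W. open N \<and> U0 \<in> N \<and> open W \<and>
        (\<forall>U\<in>N. Phi U \<in> W \<and> lax_shock D f lam U (Phi U) \<and>
               (\<forall>V\<in>W. lax_shock D f lam U V \<longrightarrow> V = Phi U)))"


section \<open>The steady boundary value problem\<close>

definition smooth_solution ::
  "(real^'n) set \<Rightarrow> (real^'n \<Rightarrow> real^'n) \<Rightarrow> (real^'n \<Rightarrow> real \<Rightarrow> real^'n) \<Rightarrow>
   real \<Rightarrow> real \<Rightarrow> (real \<Rightarrow> real^'n) \<Rightarrow> bool" where
  "smooth_solution D f a x1 x2 U \<longleftrightarrow>
     U ` {x1..x2} \<subseteq> D \<and>
     (\<exists>U'. continuous_on {x1..x2} U' \<and>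
           (\<forall>x\<in>{x1..x2}. (U has_vector_derivative U' x) (at x within {x1..x2}))) \<and>
     (\<forall>x\<in>{x1<..<x2}. ((\<lambda>t. f (U t)) has_vector_derivative a (U x) x) (at x))"

definition evolution ::
  "(real^'n) set \<Rightarrow> (real^'n \<Rightarrow> real^'n) \<Rightarrow> (real^'n \<Rightarrow> real \<Rightarrow> real^'n) \<Rightarrow>
   real \<Rightarrow> real \<Rightarrow> real^'n \<Rightarrow> real^'n" where
  "evolution D f a x1 x2 U0 =
     (THE V. \<exists>U. smooth_solution D f a x1 x2 U \<and> U x1 = U0 \<and> U x2 = V)"

text \<open>The unknowns are a vector \<open>y\<close> in \<open>real^'m\<close> with \<open>CARD('m) = I + 1\<close>. The component at the
  distinguished index \<open>s\<close> is the shock location and the other \<open>I\<close> components are the left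
  parameters. A parameter tuple is represented by the vector with \<open>s\<close>-component \<open>0\<close>; this
  allows \<open>I = 0\<close>, for which there is no type \<open>real^'i\<close>.\<close>

definition left_params :: "'m \<Rightarrow> real^'m \<Rightarrow> real^'m" where
  "left_params s y = (\<chi> i. if i = s then 0 else y $ i)"

definition param_space :: "'m \<Rightarrow> (real^'m) set" where
  "param_space s = {p. p $ s = 0}"

text \<open>A discontinuous solution is left-continuous at its shock, so \<open>U c\<close> is the state on the
  left of a shock at \<open>c\<close>; \<open>right_part c U\<close> is the right branch with its one-sided limit at \<open>c\<close>.\<close>

definition right_part :: "real \<Rightarrow> (real \<Rightarrow> 'v::t2_space) \<Rightarrow> real \<Rightarrow> 'v" where
  "right_part c U = U(c := Lim (at_right c) U)"

definition shock_solution ::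
  "(real^'n) set \<Rightarrow> (real^'n \<Rightarrow> real^'n) \<Rightarrow> (nat \<Rightarrow> real^'n \<Rightarrow> real) \<Rightarrow>
   (real^'n \<Rightarrow> real \<Rightarrow> real^'n) \<Rightarrow> real \<Rightarrow> real \<Rightarrow> 'm \<Rightarrow>
   (real^'m \<Rightarrow> real^'n) \<Rightarrow> (real^'n \<Rightarrow> real^'j) \<Rightarrow>
   real^'j \<Rightarrow> real^'m \<Rightarrow> (real \<Rightarrow> real^'n) \<Rightarrow> bool" where
  "shock_solution D f lam a xL xR s UL BR b y U \<longleftrightarrow>
     xL < y $ s \<and> y $ s < xR \<and>
     smooth_solution D f a xL (y $ s) U \<and>
     smooth_solution D f a (y $ s) xR (right_part (y $ s) U) \<and>
     lax_shock D f lam (U (y $ s)) (right_part (y $ s) U (y $ s)) \<and>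
     U xL = UL (left_params s y) \<and> BR (U xR) = b"

definition unique_shock_solution ::
  "(real^'n) set \<Rightarrow> (real^'n \<Rightarrow> real^'n) \<Rightarrow> (nat \<Rightarrow> real^'n \<Rightarrow> real) \<Rightarrow>
   (real^'n \<Rightarrow> real \<Rightarrow> real^'n) \<Rightarrow> real \<Rightarrow> real \<Rightarrow> 'm \<Rightarrow>
   (real^'m \<Rightarrow> real^'n) \<Rightarrow> (real^'n \<Rightarrow> real^'j) \<Rightarrow>
   real^'j \<Rightarrow> real^'m \<Rightarrow> (real \<Rightarrow> real^'n) \<Rightarrow> bool" where
  "unique_shock_solution D f lam a xL xR s UL BR b y U \<longleftrightarrow>
     shock_solution D f lam a xL xR s UL BR b y U \<and>
     (\<forall>z V. shock_solution D f lam a xL xR s UL BR b z V \<longrightarrow> (\<forall>x\<in>{xL..xR}. V x = U x))"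

definition L1_stable ::
  "(real^'n) set \<Rightarrow> (real^'n \<Rightarrow> real^'n) \<Rightarrow> (nat \<Rightarrow> real^'n \<Rightarrow> real) \<Rightarrow>
   (real^'n \<Rightarrow> real \<Rightarrow> real^'n) \<Rightarrow> real \<Rightarrow> real \<Rightarrow> 'm \<Rightarrow>
   (real^'m \<Rightarrow> real^'n) \<Rightarrow> (real^'n \<Rightarrow> real^'j) \<Rightarrow> bool" where
  "L1_stable D f lam a xL xR s UL BR \<longleftrightarrow>
     (\<exists>\<epsilon>>0. \<exists>C.
        (\<forall>b\<in>ball 0 \<epsilon>. \<exists>y U. unique_shock_solution D f lam a xL xR s UL BR b y U) \<and>
        (\<forall>b\<in>ball 0 \<epsilon>. \<forall>c\<in>ball 0 \<epsilon>. \<forall>y z U V.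
           shock_solution D f lam a xL xR s UL BR b y U \<longrightarrow>
           shock_solution D f lam a xL xR s UL BR c z V \<longrightarrow>
           integral {xL..xR} (\<lambda>x. norm (U x - V x)) \<le> C * norm (b - c)))"

definition regular_along ::
  "(real^'n) set \<Rightarrow> (real^'n \<Rightarrow> real^'n) \<Rightarrow> (real^'n \<Rightarrow> real \<Rightarrow> real^'n) \<Rightarrow> real \<Rightarrow> real \<Rightarrow>
   real set \<Rightarrow> (real \<Rightarrow> real^'n) \<Rightarrow> bool" where
  "regular_along D f a xL xR X U \<longleftrightarrow>
     (\<forall>x\<in>X. C11_diffeo_near f (U x) \<and>
             lipschitz_near (D \<times> {xL..xR}) (\<lambda>(V, t). a V t) (U x, x))"

text \<open>Only perturbations of the right boundary data enter \<open>L1_stable\<close>. The last group of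
  conjuncts in \<open>well_posed\<close> measures regularity of \<open>UL\<close> on parameter tuples only.\<close>

definition well_posed ::
  "(real^'n) set \<Rightarrow> (real^'n \<Rightarrow> real^'n) \<Rightarrow> (nat \<Rightarrow> real^'n \<Rightarrow> real) \<Rightarrow>
   (real^'n \<Rightarrow> real \<Rightarrow> real^'n) \<Rightarrow> real \<Rightarrow> real \<Rightarrow> 'm \<Rightarrow>
   (real^'m \<Rightarrow> real^'n) \<Rightarrow> (real^'n \<Rightarrow> real^'j) \<Rightarrow> (real^'n \<Rightarrow> real^'n) \<Rightarrow>
   real^'m \<Rightarrow> (real \<Rightarrow> real^'n) \<Rightarrow> bool" where
  "well_posed D f lam a xL xR s UL BR Phi yex Uex \<longleftrightarrow>
     (unique_shock_solution D f lam a xL xR s UL BR 0 yex Uex \<and>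
      L1_stable D f lam a xL xR s UL BR) \<and>
     (regular_along D f a xL xR {xL..yex $ s} Uex \<and>
      regular_along D f a xL xR {yex $ s..xR} (right_part (yex $ s) Uex)) \<and>
     ((\<exists>!V. lax_shock D f lam (Uex (yex $ s)) V) \<and>
      jump_operator_near D f lam Phi (Uex (yex $ s))) \<and>
     (lipschitz_near (param_space s) UL (left_params s yex) \<and>
      lipschitz_near UNIV BR (Uex xR))"


section \<open>The residual map and discrete operators\<close>

text \<open>These maps are used both for the exact operators and for their discretizations.\<close>

definition pre_shock_state ::
  "real \<Rightarrow> 'm \<Rightarrow> (real^'m \<Rightarrow> real^'n) \<Rightarrow> (real \<Rightarrow> real \<Rightarrow> real^'n \<Rightarrow> real^'n) \<Rightarrow>
   real^'m \<Rightarrow> real^'n" where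
  "pre_shock_state xL s UL P y = P xL (y $ s) (UL (left_params s y))"

definition right_end_state ::
  "real \<Rightarrow> real \<Rightarrow> 'm \<Rightarrow> (real^'m \<Rightarrow> real^'n) \<Rightarrow> (real \<Rightarrow> real \<Rightarrow> real^'n \<Rightarrow> real^'n) \<Rightarrow>
   (real^'n \<Rightarrow> real^'n) \<Rightarrow> real^'m \<Rightarrow> real^'n" where
  "right_end_state xL xR s UL P Phi y = P (y $ s) xR (Phi (pre_shock_state xL s UL P y))"

definition residual ::
  "real \<Rightarrow> real \<Rightarrow> 'm \<Rightarrow> (real^'m \<Rightarrow> real^'n) \<Rightarrow> (real^'n \<Rightarrow> real^'j) \<Rightarrow>
   (real \<Rightarrow> real \<Rightarrow> real^'n \<Rightarrow> real^'n) \<Rightarrow> (real^'n \<Rightarrow> real^'n) \<Rightarrow> real^'m \<Rightarrow> real^'j" where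
  "residual xL xR s UL BR P Phi y = BR (right_end_state xL xR s UL P Phi y)"

definition consistent_near ::
  "(real \<Rightarrow> 'a::metric_space \<Rightarrow> 'b::real_normed_vector) \<Rightarrow> ('a \<Rightarrow> 'b) \<Rightarrow> 'a \<Rightarrow> bool" where
  "consistent_near Fh F z0 \<longleftrightarrow>
     (\<exists>r>0. \<forall>z\<in>ball z0 r. ((\<lambda>h. Fh h z) \<longlongrightarrow> F z) (at_right 0))"

text \<open>Stability: the dependence on the initial state is Lipschitz with a constant that is
  independent of \<open>h\<close> and of the end point \<open>x\<close> of the interval.\<close>

definition stable_near ::
  "(real \<Rightarrow> real \<Rightarrow> 'a::metric_space \<Rightarrow> 'b::metric_space) \<Rightarrow> real \<Rightarrow> 'a \<Rightarrow> bool" where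
  "stable_near Fh x0 U0 \<longleftrightarrow>
     (\<exists>L. \<exists>r>0. \<exists>h0>0. \<forall>h\<in>{0<..h0}. \<forall>x\<in>ball x0 r. L-lipschitz_on (ball U0 r) (Fh h x))"

definition accurate_near ::
  "real \<Rightarrow> (real \<Rightarrow> 'a::metric_space \<Rightarrow> 'b::real_normed_vector) \<Rightarrow> ('a \<Rightarrow> 'b) \<Rightarrow> 'a \<Rightarrow> bool" where
  "accurate_near k Fh F z0 \<longleftrightarrow>
     (\<exists>C. \<exists>r>0. \<exists>h0>0. \<forall>h\<in>{0<..h0}. \<forall>z\<in>ball z0 r. norm (Fh h z - F z) \<le> C * h powr k)"

text \<open>Lipschitz dependence on the unknowns; the constant may depend on \<open>h\<close>.\<close>

definition lipschitz_in_unknowns ::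
  "real \<Rightarrow> real \<Rightarrow> 'm \<Rightarrow> (real^'m \<Rightarrow> real^'n) \<Rightarrow>
   (real \<Rightarrow> real \<Rightarrow> real \<Rightarrow> real^'n \<Rightarrow> real^'n) \<Rightarrow> (real \<Rightarrow> real^'n \<Rightarrow> real^'n) \<Rightarrow>
   real^'m \<Rightarrow> bool" where
  "lipschitz_in_unknowns xL xR s UL Ph Phih yex \<longleftrightarrow>
     (\<exists>r>0. \<exists>h0>0. \<forall>h\<in>{0<..h0}. \<exists>L.
        L-lipschitz_on (ball yex r) (pre_shock_state xL s UL (Ph h)) \<and>
        L-lipschitz_on (ball yex r) (\<lambda>y. Phih h (pre_shock_state xL s UL (Ph h) y)) \<and>
        L-lipschitz_on (ball yex r) (right_end_state xL xR s UL (Ph h) (Phih h)))"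

end

theory Submission
  imports Defs
begin

text \<open>The discrete residual differs from the exact one by \<open>O(h^k)\<close>, so a discrete solution \<open>y\<close> has
  an exact residual \<open>b\<close> of size \<open>O(h^k)\<close>. It remains to bound \<open>y - yex\<close> by a constant times \<open>b\<close>.
  If \<open>y\<close> are the parameters of a shock solution \<open>U\<close> for the perturbed right data \<open>b\<close>, stability
  bounds the \<open>L1\<close> distance of \<open>U\<close> and \<open>Uex\<close> by \<open>b\<close>, and that distance in turn controls the
  parameters (\<open>parameters_bounded_by_L1_distance\<close>): a difference of the left states is propagated by
  the ODE over a whole interval, and displacing the shock by \<open>d\<close> costs about \<open>d\<close> times the jump.

  The delicate point is that every \<open>y\<close> near \<open>yex\<close> belongs to a shock solution. Stability
  provides solutions for every small \<open>b\<close> but does not let one prescribe \<open>y\<close>. However, the parameters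
  \<open>y(b)\<close> of these solutions depend continuously on \<open>b\<close>, and \<open>b\<close> is recovered from \<open>y(b)\<close> as its exact
  residual. Since there are as many parameters as right boundary conditions, \<open>b \<mapsto> y(b)\<close> is an open
  map by invariance of domain, and the parameters so attained fill a neighbourhood of \<open>yex\<close>
  (\<open>parameters_near_exact_are_attained\<close>).

  Two facts support this. First, a shock solution that is \<open>L1\<close>-close to \<open>Uex\<close> is uniformly close
  to it on both sides of the shock (\<open>close_if_L1_close\<close>): Gronwall's inequality turns closeness at
  single points into closeness on intervals, and a branch passing smoothly through the exact shock
  position would have to be close to both of the distinct states there. Uniform closeness makes the
  implicitly defined operators \<open>evolution\<close> and \<open>Phi\<close> return the values of the solution
  (\<open>exact_operators_on_close_solutions\<close>). Second, the jump operator is Lipschitz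
  (\<open>jump_operator_lipschitz\<close>), which is needed to propagate the error through the shock. Near the
  exact states it must coincide with a local inverse of the flux composed with the flux, because the
  Lax inequalities are open conditions; this rests on the continuity of the simple eigenvalues of the
  Jacobian (\<open>ordered_eigenvalues_tendsto\<close>).\<close>

section \<open>Continuity of simple real eigenvalues\<close>

text \<open>Applying \<open>A - \<mu> k\<close> to a linear relation removes the term of index \<open>k\<close> and multiplies the others by
  the nonzero factors \<open>\<mu> i - \<mu> k\<close>, which gives an induction on the number of terms.\<close>

lemma eigenvectors_independent:
  fixes A :: "real^'n^'n" and v :: "'i \<Rightarrow> real^'n"
  assumes "finite S" and "inj_on \<mu> S"
    and "\<And>i. i \<in> S \<Longrightarrow> v i \<noteq> 0 \<and> A *v v i = \<mu> i *\<^sub>R v i"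
    and "(\<Sum>i\<in>S. w i *\<^sub>R v i) = 0" and "i \<in> S"
  shows "w i = 0"
  using assms
proof (induction S arbitrary: w i rule: finite_induct)
  case empty
  then show ?case by simp
next
  case (insert k S)
  have split: "w k *\<^sub>R v k + (\<Sum>i\<in>S. w i *\<^sub>R v i) = 0"
    using insert by simp
  then have "A *v (w k *\<^sub>R v k + (\<Sum>i\<in>S. w i *\<^sub>R v i)) = 0"
    by simp
  moreover have "A *v (w k *\<^sub>R v k + (\<Sum>i\<in>S. w i *\<^sub>R v i))
      = w k *\<^sub>R (\<mu> k *\<^sub>R v k) + (\<Sum>i\<in>S. w i *\<^sub>R (\<mu> i *\<^sub>R v i))"
    using insert.prems(2)
    by (simp add: matrix_vector_right_distrib linear_sum[OF matrix_vector_mul_linear]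
        matrix_vector_mult_scaleR)
  ultimately have applied: "w k *\<^sub>R (\<mu> k *\<^sub>R v k) + (\<Sum>i\<in>S. w i *\<^sub>R (\<mu> i *\<^sub>R v i)) = 0"
    by simp
  have "(\<Sum>i\<in>S. (w i * (\<mu> i - \<mu> k)) *\<^sub>R v i)
      = (\<Sum>i\<in>S. w i *\<^sub>R (\<mu> i *\<^sub>R v i)) - \<mu> k *\<^sub>R (\<Sum>i\<in>S. w i *\<^sub>R v i)"
    unfolding scaleR_sum_right sum_subtractf[symmetric]
    by (intro sum.cong refl) (simp add: algebra_simps)
  also have "(\<Sum>i\<in>S. w i *\<^sub>R v i) = - (w k *\<^sub>R v k)"
    using split by (simp add: add_eq_0_iff)
  also have "(\<Sum>i\<in>S. w i *\<^sub>R (\<mu> i *\<^sub>R v i)) - \<mu> k *\<^sub>R (- (w k *\<^sub>R v k)) = 0"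
    using applied by (simp add: add.commute mult.commute)
  finally have comb: "(\<Sum>i\<in>S. (w i * (\<mu> i - \<mu> k)) *\<^sub>R v i) = 0" .
  have "w i * (\<mu> i - \<mu> k) = 0" if "i \<in> S" for i
    by (rule insert.IH[OF inj_on_subset[OF insert.prems(1) subset_insertI] _ comb that])
      (rule insert.prems(2), simp)
  moreover have "\<mu> i \<noteq> \<mu> k" if "i \<in> S" for i
    using inj_onD[OF insert.prems(1), of i k] insert.hyps(2) that by auto
  ultimately have S0: "w i = 0" if "i \<in> S" for i
    using that by (metis eq_iff_diff_eq_0 mult_eq_0_iff)
  then have "w k *\<^sub>R v k = 0" using split by simp
  then have "w k = 0" using insert.prems(2)[of k] by simp
  then show ?case using S0 insert.prems(4) by auto
qed

text \<open>The matrix is diagonalized by its \<open>n\<close> independent eigenvectors. This product formula replaces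
  the characteristic polynomial in what follows.\<close>

lemma det_shift_eq_prod_eigenvalues:
  fixes A :: "real^'n^'n"
  assumes eig: "\<And>i. i \<in> {1..CARD('n)} \<Longrightarrow> is_eigenvalue A (\<mu> i)"
    and inj: "inj_on \<mu> {1..CARD('n)}"
  shows "det (A - mat t) = (\<Prod>i\<in>{1..CARD('n)}. \<mu> i - t)"
proof -
  obtain v where v: "\<And>i. i \<in> {1..CARD('n)} \<Longrightarrow> v i \<noteq> 0 \<and> A *v v i = \<mu> i *\<^sub>R v i"
    using eig unfolding is_eigenvalue_def by metis
  \<comment> \<open>The eigenvalues are numbered by naturals, the matrix columns by the type \<open>'n\<close>.\<close>
  obtain \<beta> where \<beta>: "bij_betw \<beta> (UNIV :: 'n set) {1..CARD('n)}"
    using finite_same_card_bij[of "UNIV :: 'n set" "{1..CARD('n)}"] by auto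
  have \<beta>in: "\<beta> j \<in> {1..CARD('n)}" for j
    using \<beta> by (auto simp: bij_betw_def)
  define P where "P = (\<chi> i j. v (\<beta> j) $ i)"
  define Q where "Q = (\<chi> i j. if i = j then \<mu> (\<beta> j) - t else 0)"
  have "w = 0" if "P *v w = 0" for w
  proof -
    have "(\<Sum>j\<in>UNIV. (w $ j) *\<^sub>R v (\<beta> j)) = 0"
      using that by (simp add: P_def matrix_vector_mult_def vec_eq_iff mult.commute)
    moreover have "inj_on (\<mu> \<circ> \<beta>) UNIV"
      using \<beta> inj by (auto simp: bij_betw_def intro!: comp_inj_on)
    ultimately have "w $ j = 0" for j
      using eigenvectors_independent[of UNIV "\<mu> \<circ> \<beta>" "v \<circ> \<beta>" A "\<lambda>j. w $ j" j] v \<beta>in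
      by simp
    then show ?thesis by (simp add: vec_eq_iff)
  qed
  then have "invertible P"
    unfolding invertible_left_inverse matrix_left_invertible_ker by blast
  then have P0: "det P \<noteq> 0" by (simp add: invertible_det_nz)
  have "(A - mat t) ** P = P ** Q"
  proof -
    have "((A - mat t) ** P) $ i $ j = (P ** Q) $ i $ j" for i j
    proof -
      have "((A - mat t) ** P) $ i $ j
          = (\<Sum>k\<in>UNIV. A $ i $ k * v (\<beta> j) $ k) - (\<Sum>k\<in>UNIV. (if i = k then t else 0) * v (\<beta> j) $ k)"
        by (simp add: matrix_matrix_mult_def P_def mat_def left_diff_distrib sum_subtractf)
      also have "(\<Sum>k\<in>UNIV. A $ i $ k * v (\<beta> j) $ k) = (A *v v (\<beta> j)) $ i"
        by (simp add: matrix_vector_mult_def)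
      also have "\<dots> = \<mu> (\<beta> j) * v (\<beta> j) $ i"
        using v \<beta>in by simp
      also have "(\<Sum>k\<in>UNIV. (if i = k then t else 0) * v (\<beta> j) $ k) = t * v (\<beta> j) $ i"
      proof -
        have "(\<Sum>k\<in>UNIV. (if i = k then t else 0) * v (\<beta> j) $ k)
            = (\<Sum>k\<in>UNIV. if i = k then t * v (\<beta> j) $ k else 0)"
          by (intro sum.cong) auto
        then show ?thesis by simp
      qed
      also have "\<mu> (\<beta> j) * v (\<beta> j) $ i - t * v (\<beta> j) $ i
          = (\<Sum>k\<in>UNIV. if k = j then v (\<beta> k) $ i * (\<mu> (\<beta> j) - t) else 0)"
        by (simp add: algebra_simps)
      also have "\<dots> = (P ** Q) $ i $ j"
        unfolding matrix_matrix_mult_def P_def Q_def vec_lambda_beta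
        by (intro sum.cong refl) simp
      finally show ?thesis .
    qed
    then show ?thesis by (simp add: vec_eq_iff)
  qed
  then have "det (A - mat t) * det P = det P * det Q"
    by (metis det_mul)
  then have "det (A - mat t) = det Q" using P0 by simp
  also have "\<dots> = (\<Prod>j\<in>UNIV. \<mu> (\<beta> j) - t)"
    by (subst det_diagonal) (auto simp: Q_def)
  also have "\<dots> = (\<Prod>i\<in>{1..CARD('n)}. \<mu> i - t)"
    by (rule prod.reindex_bij_betw[OF \<beta>])
  finally show ?thesis .
qed

lemma tendsto_det:
  fixes M :: "'a \<Rightarrow> real^'n^'n"
  assumes "(M \<longlongrightarrow> A) F"
  shows "((\<lambda>x. det (M x)) \<longlongrightarrow> det A) F"
  unfolding det_def
  by (intro tendsto_sum tendsto_mult tendsto_const tendsto_prod tendsto_vec_nth assms)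

lemma consecutive_less_imp_less:
  fixes g :: "nat \<Rightarrow> real"
  assumes "\<And>i. i \<in> {1..<n} \<Longrightarrow> g i < g (i + 1)" and "1 \<le> i" "i < j" "j \<le> n"
  shows "g i < g j"
  using \<open>i < j\<close> \<open>j \<le> n\<close>
proof (induction j rule: less_induct)
  case (less j)
  show ?case
  proof (cases "i < j - 1")
    case True
    then have "g i < g (j - 1)" using less by auto
    also have "g (j - 1) < g j" using assms(1)[of "j - 1"] less.prems assms(2) True by auto
    finally show ?thesis .
  next
    case False
    then show ?thesis using assms(1)[of i] assms(2) less.prems
      by (metis Suc_diff_1 Suc_eq_plus1 atLeastLessThan_iff less_SucE less_nat_zero_code
          linorder_not_less nat_less_le not_gr_zero order_less_le_trans)
  qed
qed

lemma increasing_self_map_id: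
  fixes \<tau> :: "nat \<Rightarrow> nat"
  assumes map: "\<And>i. i \<in> {1..n} \<Longrightarrow> \<tau> i \<in> {1..n}"
    and less: "\<And>i. i \<in> {1..<n} \<Longrightarrow> \<tau> i < \<tau> (i + 1)"
    and i: "i \<in> {1..n}"
  shows "\<tau> i = i"
proof (rule antisym)
  have "1 \<le> i \<Longrightarrow> i \<le> n \<Longrightarrow> i \<le> \<tau> i"
  proof (induction i rule: nat_induct_at_least[of 1])
    case base
    then show ?case using map[of 1] by simp
  next
    case (Suc m)
    then show ?case using less[of m] by simp
  qed
  then show "i \<le> \<tau> i" using i by simp
  have "i \<le> n" using i by simp
  then show "\<tau> i \<le> i"
    using i
  proof (induction rule: inc_induct)
    case base
    then show ?case using map[of n] by simp
  next
    case (step m)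
    then show ?case using less[of m] by simp
  qed
qed

text \<open>For small \<open>d\<close>, the product of \<open>det (A - t)\<close> at \<open>t = \<mu> j - d\<close> and \<open>t = \<mu> j + d\<close> is
  \<open>\<Prod>k. (\<mu> k - \<mu> j)\<^sup>2 - d\<^sup>2\<close>, in which only the factor \<open>k = j\<close> is negative. The sign of this product
  persists for nearby matrices, and by the same formula a negative product forces one of their
  eigenvalues into the interval of radius \<open>d\<close> about \<open>\<mu> j\<close>. These \<open>n\<close> intervals are disjoint and ordered,
  so the \<open>j\<close>-th of them contains the \<open>j\<close>-th eigenvalue.\<close>

lemma ordered_eigenvalues_tendsto:
  fixes M :: "'a \<Rightarrow> real^'n^'n" and lam :: "nat \<Rightarrow> 'a \<Rightarrow> real"
  assumes M: "(M \<longlongrightarrow> A) F"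
    and ev: "eventually (\<lambda>x. (\<forall>i\<in>{1..CARD('n)}. is_eigenvalue (M x) (lam i x)) \<and>
                 (\<forall>i\<in>{1..<CARD('n)}. lam i x < lam (i + 1) x)) F"
    and eig: "\<And>i. i \<in> {1..CARD('n)} \<Longrightarrow> is_eigenvalue A (\<mu> i)"
    and ord: "\<And>i. i \<in> {1..<CARD('n)} \<Longrightarrow> \<mu> i < \<mu> (i + 1)"
    and i: "i \<in> {1..CARD('n)}"
  shows "((\<lambda>x. lam i x) \<longlongrightarrow> \<mu> i) F"
proof (rule tendstoI)
  fix e :: real assume e: "e > 0"
  let ?N = "CARD('n)"
  have inj: "inj_on g {1..?N}" if "\<And>i. i \<in> {1..<?N} \<Longrightarrow> g i < g (i + 1)" for g :: "nat \<Rightarrow> real"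
    using consecutive_less_imp_less[of ?N g, OF that]
    by (auto simp: inj_on_def) (metis linorder_neqE_nat order_less_irrefl)
  have "eventually (\<lambda>d. (\<forall>i\<in>{1..<?N}. 2 * d < \<mu> (i + 1) - \<mu> i) \<and> d < e \<and> 0 < d) (at_right 0)"
  proof (intro eventually_conj eventually_ball_finite)
    show "\<forall>i\<in>{1..<?N}. \<forall>\<^sub>F d in at_right 0. 2 * d < \<mu> (i + 1) - \<mu> i"
    proof
      fix i assume "i \<in> {1..<?N}"
      then have "0 < (\<mu> (i + 1) - \<mu> i) / 2" using ord by simp
      then show "\<forall>\<^sub>F d in at_right 0. 2 * d < \<mu> (i + 1) - \<mu> i"
        by (auto simp: eventually_at_right_field intro!: exI[of _ "(\<mu> (i + 1) - \<mu> i) / 2"])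
    qed
  qed (use e in \<open>auto simp: eventually_at_right_field\<close>)
  then obtain d where d: "\<And>i. i \<in> {1..<?N} \<Longrightarrow> 2 * d < \<mu> (i + 1) - \<mu> i" "d < e" "0 < d"
    by (metis (no_types, lifting) eventually_happens' trivial_limit_at_right_real)
  have gap: "2 * d < \<mu> k - \<mu> j" if "1 \<le> j" "j < k" "k \<le> ?N" for j k
  proof -
    have "\<mu> (j + 1) \<le> \<mu> k"
      using consecutive_less_imp_less[of ?N \<mu> "j + 1" k, OF ord] that
      by (cases "j + 1 = k") auto
    then show ?thesis using d(1)[of j] that by auto
  qed
  \<comment> \<open>Negative exactly when \<open>det (B - t)\<close> changes sign between \<open>\<mu> j - d\<close> and \<open>\<mu> j + d\<close>.\<close>
  define q where "q j B = det (B - mat (\<mu> j - d)) * det (B - mat (\<mu> j + d))" for j and B :: "real^'n^'n"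
  have q_eq: "q j B = (\<Prod>k\<in>{1..?N}. (\<nu> k - \<mu> j)\<^sup>2 - d\<^sup>2)"
    if "\<And>i. i \<in> {1..?N} \<Longrightarrow> is_eigenvalue B (\<nu> i)" "\<And>i. i \<in> {1..<?N} \<Longrightarrow> \<nu> i < \<nu> (i + 1)"
    for j B \<nu>
    unfolding q_def det_shift_eq_prod_eigenvalues[of B \<nu>, OF that(1) inj[of \<nu>, OF that(2)], simplified]
      prod.distrib[symmetric]
    by (intro prod.cong) (auto simp: power2_eq_square algebra_simps)
  have q_neg: "q j A < 0" if j: "j \<in> {1..?N}" for j
  proof -
    have "q j A = ((\<mu> j - \<mu> j)\<^sup>2 - d\<^sup>2) * (\<Prod>k\<in>{1..?N} - {j}. (\<mu> k - \<mu> j)\<^sup>2 - d\<^sup>2)"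
      using q_eq[of A \<mu> j, OF eig ord] j by (simp add: prod.remove)
    moreover have "(\<Prod>k\<in>{1..?N} - {j}. (\<mu> k - \<mu> j)\<^sup>2 - d\<^sup>2) > 0"
    proof (rule prod_pos)
      fix k assume k: "k \<in> {1..?N} - {j}"
      then have "d < \<bar>\<mu> k - \<mu> j\<bar>"
        using gap[of j k] gap[of k j] j d(3) by (cases "j < k") auto
      then have "d\<^sup>2 < \<bar>\<mu> k - \<mu> j\<bar>\<^sup>2" using d(3) by (intro power_strict_mono) auto
      then show "0 < (\<mu> k - \<mu> j)\<^sup>2 - d\<^sup>2" by simp
    qed
    ultimately show ?thesis using d(3) by (simp add: mult_pos_pos)
  qed
  have "eventually (\<lambda>x. \<forall>j\<in>{1..?N}. q j (M x) < 0) F"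
  proof (intro eventually_ball_finite ballI)
    fix j assume "j \<in> {1..?N}"
    have "((\<lambda>x. q j (M x)) \<longlongrightarrow> q j A) F"
      unfolding q_def by (intro tendsto_mult tendsto_det tendsto_diff tendsto_const M)
    then show "\<forall>\<^sub>F x in F. q j (M x) < 0"
      using q_neg[OF \<open>j \<in> {1..?N}\<close>] by (rule order_tendstoD)
  qed simp
  then show "\<forall>\<^sub>F x in F. dist (lam i x) (\<mu> i) < e"
    using ev
  proof eventually_elim
    case (elim x)
    have ex: "\<exists>k\<in>{1..?N}. \<bar>lam k x - \<mu> j\<bar> < d" if j: "j \<in> {1..?N}" for j
    proof (rule ccontr)
      assume "\<not> ?thesis"
      then have "d\<^sup>2 \<le> \<bar>lam k x - \<mu> j\<bar>\<^sup>2" if "k \<in> {1..?N}" for k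
        using that d(3) by (intro power_mono) (auto simp: not_less)
      then have "0 \<le> (\<Prod>k\<in>{1..?N}. (lam k x - \<mu> j)\<^sup>2 - d\<^sup>2)"
        by (intro prod_nonneg) auto
      then show False
        using q_eq[of "M x" "\<lambda>k. lam k x" j] elim j by fastforce
    qed
    then obtain \<tau> where \<tau>: "\<And>j. j \<in> {1..?N} \<Longrightarrow> \<tau> j \<in> {1..?N} \<and> \<bar>lam (\<tau> j) x - \<mu> j\<bar> < d"
      by metis
    have "\<tau> i = i"
    proof (rule increasing_self_map_id[of ?N \<tau>])
      fix j assume j: "j \<in> {1..<?N}"
      then have "lam (\<tau> j) x < lam (\<tau> (j + 1)) x"
        using \<tau>[of j] \<tau>[of "j + 1"] d(1)[of j] by auto
      moreover have "lam (\<tau> (j + 1)) x \<le> lam (\<tau> j) x" if "\<tau> (j + 1) \<le> \<tau> j"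
        using consecutive_less_imp_less[of ?N "\<lambda>k. lam k x" "\<tau> (j + 1)" "\<tau> j"] elim that
          \<tau>[of j] \<tau>[of "j + 1"] j by (cases "\<tau> (j + 1) = \<tau> j") auto
      ultimately show "\<tau> j < \<tau> (j + 1)" by linarith
    qed (use \<tau> i in auto)
    then show ?case using \<tau>[OF i] d(2) by (simp add: dist_real_def)
  qed
qed

section \<open>Regularity of the flux and of the jump operator\<close>

lemma C11_on_locally_lipschitz:
  fixes g :: "'a::real_normed_vector \<Rightarrow> 'b::real_normed_vector"
  assumes "C11_on g N" and "open N" and "z \<in> N"
  obtains r K where "r > 0" "ball z r \<subseteq> N" "K \<ge> 0"
    "\<And>u v. u \<in> ball z r \<Longrightarrow> v \<in> ball z r \<Longrightarrow> norm (g u - g v) \<le> K * norm (u - v)"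
proof -
  obtain g' L where g': "\<And>w. w \<in> N \<Longrightarrow> (g has_derivative blinfun_apply (g' w)) (at w)"
    and L: "L-lipschitz_on N g'"
    using assms(1) unfolding C11_on_def by blast
  obtain r where r: "r > 0" "ball z r \<subseteq> N"
    using assms(2,3) open_contains_ball by blast
  have L0: "L \<ge> 0" using L by (rule lipschitz_on_nonneg)
  define K where "K = norm (g' z) + L * r"
  have bound: "onorm (blinfun_apply (g' w)) \<le> K" if "w \<in> ball z r" for w
  proof -
    have "norm (g' w - g' z) \<le> L * dist w z"
      using lipschitz_onD[OF L, of w z] that r assms(3) by (auto simp: dist_norm)
    also have "\<dots> \<le> L * r"
      using that L0 by (intro mult_left_mono) (auto simp: dist_commute)
    finally have "norm (g' w) \<le> K"
      unfolding K_def using norm_triangle_ineq2[of "g' w" "g' z"] by linarith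
    then show ?thesis by (simp add: norm_blinfun.rep_eq)
  qed
  show thesis
  proof
    show "r > 0" "ball z r \<subseteq> N" by (fact r)+
    show "K \<ge> 0" using L0 r(1) by (simp add: K_def)
    fix u v assume "u \<in> ball z r" "v \<in> ball z r"
    then show "norm (g u - g v) \<le> K * norm (u - v)"
      using r(2) bound
      by (intro differentiable_bound[of "ball z r" g "\<lambda>w. blinfun_apply (g' w)"])
        (auto intro!: has_derivative_at_withinI g')
  qed
qed

text \<open>The upper bound is the local Lipschitz bound of the map, the lower one that of its inverse.\<close>

lemma C11_diffeo_bilipschitz:
  fixes f :: "'a::real_normed_vector \<Rightarrow> 'b::real_normed_vector"
  assumes "C11_diffeo_near f z"
  obtains r K where "r > 0" "K \<ge> 0"
    "\<And>u v. u \<in> ball z r \<Longrightarrow> v \<in> ball z r \<Longrightarrow>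
       norm (f u - f v) \<le> K * norm (u - v) \<and> norm (u - v) \<le> K * norm (f u - f v)"
proof -
  obtain N k where N: "open N" "z \<in> N" "open (f ` N)" "\<And>w. w \<in> N \<Longrightarrow> k (f w) = w"
    and C: "C11_on f N" "C11_on k (f ` N)"
    using assms unfolding C11_diffeo_near_def by blast
  obtain r1 K1 where 1: "r1 > 0" "ball z r1 \<subseteq> N" "K1 \<ge> 0"
    "\<And>u v. u \<in> ball z r1 \<Longrightarrow> v \<in> ball z r1 \<Longrightarrow> norm (f u - f v) \<le> K1 * norm (u - v)"
    using C11_on_locally_lipschitz[OF C(1) N(1,2)] by metis
  obtain r2 K2 where 2: "r2 > 0" "ball (f z) r2 \<subseteq> f ` N" "K2 \<ge> 0"
    "\<And>u v. u \<in> ball (f z) r2 \<Longrightarrow> v \<in> ball (f z) r2 \<Longrightarrow> norm (k u - k v) \<le> K2 * norm (u - v)"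
    using C11_on_locally_lipschitz[OF C(2) N(3), of "f z"] N(2) by (metis imageI)
  define r where "r = min r1 (r2 / (K1 + 1))"
  have r: "r > 0" using 1 2 by (simp add: r_def)
  have img: "f u \<in> ball (f z) r2" if u: "u \<in> ball z r" for u
  proof -
    have "norm (f u - f z) \<le> K1 * norm (u - z)"
      using 1(1,4) u by (simp add: r_def)
    also have "\<dots> \<le> (K1 + 1) * norm (u - z)"
      by (simp add: mult_right_mono)
    also have "\<dots> < (K1 + 1) * (r2 / (K1 + 1))"
      using u 1(3) by (intro mult_strict_left_mono) (auto simp: r_def dist_norm norm_minus_commute)
    also have "\<dots> = r2" using 1(3) by simp
    finally show ?thesis by (simp add: dist_norm norm_minus_commute)
  qed
  show thesis
  proof (rule that[of r "max K1 K2"])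
    fix u v assume uv: "u \<in> ball z r" "v \<in> ball z r"
    then have "norm (f u - f v) \<le> K1 * norm (u - v)"
      using 1(4) by (simp add: r_def)
    also have "\<dots> \<le> max K1 K2 * norm (u - v)" by (intro mult_right_mono) auto
    finally have a: "norm (f u - f v) \<le> max K1 K2 * norm (u - v)" .
    have "u \<in> N" "v \<in> N" using uv 1(2) by (auto simp: r_def subset_iff)
    then have "norm (u - v) \<le> K2 * norm (f u - f v)"
      using 2(4)[OF img[OF uv(1)] img[OF uv(2)]] N(4) by simp
    also have "\<dots> \<le> max K1 K2 * norm (f u - f v)" by (intro mult_right_mono) auto
    finally show "norm (f u - f v) \<le> max K1 K2 * norm (u - v) \<and>
        norm (u - v) \<le> max K1 K2 * norm (f u - f v)"
      using a by simp
  qed (use r 1 in auto)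
qed

lemma jacobian_tendsto:
  fixes f :: "real^'n \<Rightarrow> real^'n"
  assumes "C11_diffeo_near f z"
  shows "((\<lambda>U. jacobian f (at U)) \<longlongrightarrow> jacobian f (at z)) (at z)"
proof -
  obtain N where N: "open N" "z \<in> N" "C11_on f N"
    using assms unfolding C11_diffeo_near_def by blast
  then obtain f' L where f': "\<And>w. w \<in> N \<Longrightarrow> (f has_derivative blinfun_apply (f' w)) (at w)"
    and L: "L-lipschitz_on N f'"
    unfolding C11_on_def by blast
  have jac: "jacobian f (at w) = matrix (blinfun_apply (f' w))" if "w \<in> N" for w
    using frechet_derivative_at[OF f'[OF that]] by (simp add: jacobian_def)
  have "(f' \<longlongrightarrow> f' z) (at z)"
    using lipschitz_on_continuous_on[OF L] N by (simp add: continuous_on_eq_continuous_at isCont_def)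
  then have "((\<lambda>w. matrix (blinfun_apply (f' w))) \<longlongrightarrow> matrix (blinfun_apply (f' z))) (at z)"
    unfolding matrix_def
    by (intro vec_tendstoI)
      (simp add: tendsto_vec_nth bounded_bilinear.tendsto[OF bounded_bilinear_blinfun_apply])
  moreover have "eventually (\<lambda>w. matrix (blinfun_apply (f' w)) = jacobian f (at w)) (at z)"
    unfolding eventually_at_topological using N jac by (intro exI[of _ N]) auto
  ultimately show ?thesis
    unfolding jac[OF N(2)] by (rule Lim_transform_eventually)
qed

lemma isCont_ordered_eigenvalue:
  fixes f :: "real^'n \<Rightarrow> real^'n"
  assumes "open D" and "strictly_hyperbolic D f lam" and "z \<in> D"
    and "C11_diffeo_near f z" and "i \<in> {1..CARD('n)}"
  shows "isCont (lam i) z"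
  unfolding isCont_def
proof (rule ordered_eigenvalues_tendsto[OF jacobian_tendsto[OF assms(4)] _ _ _ assms(5)])
  show "\<forall>\<^sub>F U in at z. (\<forall>i\<in>{1..CARD('n)}. is_eigenvalue (jacobian f (at U)) (lam i U)) \<and>
      (\<forall>i\<in>{1..<CARD('n)}. lam i U < lam (i + 1) U)"
    using assms(1-3) unfolding strictly_hyperbolic_def eventually_at_topological by blast
qed (use assms(2,3) in \<open>auto simp: strictly_hyperbolic_def\<close>)

text \<open>With a local inverse \<open>k\<close> of \<open>f\<close> at \<open>V0 = Phi U0\<close>, the state \<open>k (f U)\<close> tends to \<open>V0\<close> as
  \<open>U\<close> tends to \<open>U0\<close> and has the same flux as \<open>U\<close>. Eigenvalues being continuous, the strict Lax
  inequalities of \<open>(U0, V0)\<close> carry over to \<open>(U, k (f U))\<close> with the same field index, so uniqueness of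
  the partner in \<open>W\<close> identifies \<open>k (f U)\<close> with \<open>Phi U\<close>.\<close>

lemma jump_operator_continuous:
  fixes f :: "real^'n \<Rightarrow> real^'n"
  assumes D: "open D" and hyp: "strictly_hyperbolic D f lam"
    and jump: "jump_operator_near D f lam Phi U0"
    and reg0: "C11_diffeo_near f U0" and reg1: "C11_diffeo_near f (Phi U0)"
  shows "isCont Phi U0"
proof -
  obtain N W where N: "open N" "U0 \<in> N" "open W"
    and NW: "\<And>U. U \<in> N \<Longrightarrow> Phi U \<in> W \<and> lax_shock D f lam U (Phi U)"
    and uniq: "\<And>U V. U \<in> N \<Longrightarrow> V \<in> W \<Longrightarrow> lax_shock D f lam U V \<Longrightarrow> V = Phi U"
    using jump unfolding jump_operator_near_def by metis
  define V0 where "V0 = Phi U0"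
  have lax: "lax_shock D f lam U0 V0" and W: "V0 \<in> W" using NW N(2) by (auto simp: V0_def)
  then have inD: "U0 \<in> D" "V0 \<in> D" and ne: "V0 \<noteq> U0" and RH: "f V0 = f U0"
    unfolding lax_shock_def by auto
  obtain j where j: "j \<in> {1..CARD('n)}" "lam j V0 < 0" "0 < lam j U0"
    "1 < j \<Longrightarrow> lam (j - 1) U0 < 0" "j < CARD('n) \<Longrightarrow> 0 < lam (j + 1) V0"
    using lax unfolding lax_shock_def by blast
  obtain N' k where N': "open N'" "V0 \<in> N'" "open (f ` N')" "\<And>w. w \<in> N' \<Longrightarrow> k (f w) = w"
    and C: "C11_on k (f ` N')"
    using reg1 unfolding C11_diffeo_near_def V0_def[symmetric] by blast
  have fU0: "f U0 \<in> f ` N'" using RH N'(2) by (metis imageI)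
  have f_lim: "(f \<longlongrightarrow> f U0) (nhds U0)"
  proof -
    have "f differentiable (at U0)" using hyp inD(1) unfolding strictly_hyperbolic_def by blast
    then show ?thesis
      using differentiable_imp_continuous_within[of f U0 UNIV]
      by (simp add: isCont_def tendsto_at_iff_tendsto_nhds)
  qed
  have k_lim: "(k \<longlongrightarrow> V0) (nhds (f U0))"
  proof -
    obtain k' where "(k has_derivative k') (at (f U0))"
      using C fU0 unfolding C11_on_def by blast
    then have "isCont k (f U0)" by (rule has_derivative_continuous)
    then show ?thesis
      using N'(2,4) RH by (simp add: isCont_def tendsto_at_iff_tendsto_nhds) (metis)
  qed
  let ?p = "\<lambda>U. k (f U)"
  have p_lim: "(?p \<longlongrightarrow> V0) (nhds U0)"
    by (rule filterlim_compose[OF k_lim f_lim])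
  have lamU: "(lam i \<longlongrightarrow> lam i U0) (nhds U0)" if "i \<in> {1..CARD('n)}" for i
    using isCont_ordered_eigenvalue[OF D hyp inD(1) reg0 that]
    by (simp add: isCont_def tendsto_at_iff_tendsto_nhds)
  have lamV: "((\<lambda>U. lam i (?p U)) \<longlongrightarrow> lam i V0) (nhds U0)" if "i \<in> {1..CARD('n)}" for i
  proof (rule filterlim_compose[OF _ p_lim])
    show "(lam i \<longlongrightarrow> lam i V0) (nhds V0)"
      using isCont_ordered_eigenvalue[OF D hyp inD(2) _ that] reg1
      by (simp add: isCont_def tendsto_at_iff_tendsto_nhds V0_def)
  qed
  have ev_ne: "\<forall>\<^sub>F U in nhds U0. ?p U \<noteq> U"
  proof -
    have "((\<lambda>U. ?p U - U) \<longlongrightarrow> V0 - U0) (nhds U0)"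
      by (intro tendsto_diff p_lim filterlim_ident)
    then have "\<forall>\<^sub>F U in nhds U0. ?p U - U \<noteq> 0"
      by (rule tendsto_imp_eventually_ne) (use ne in simp)
    then show ?thesis by simp
  qed
  have ev_j: "\<forall>\<^sub>F U in nhds U0. lam j (?p U) < 0" "\<forall>\<^sub>F U in nhds U0. 0 < lam j U"
    using order_tendstoD(2)[OF lamV[OF j(1)] j(2)] order_tendstoD(1)[OF lamU[OF j(1)] j(3)] .
  have ev_below: "\<forall>\<^sub>F U in nhds U0. 1 < j \<longrightarrow> lam (j - 1) U < 0"
  proof (cases "1 < j")
    case True
    then have "j - 1 \<in> {1..CARD('n)}" using j(1) by auto
    then show ?thesis using order_tendstoD(2)[OF lamU j(4)[OF True]] by (auto elim: eventually_mono)
  qed simp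
  have ev_above: "\<forall>\<^sub>F U in nhds U0. j < CARD('n) \<longrightarrow> 0 < lam (j + 1) (?p U)"
  proof (cases "j < CARD('n)")
    case True
    then have "j + 1 \<in> {1..CARD('n)}" using j(1) by auto
    then show ?thesis using order_tendstoD(1)[OF lamV j(5)[OF True]] by (auto elim: eventually_mono)
  qed simp
  have ev_D: "\<forall>\<^sub>F U in nhds U0. U \<in> D \<and> U \<in> N \<and> f U \<in> f ` N' \<and> ?p U \<in> D \<and> ?p U \<in> W"
    using topological_tendstoD[OF filterlim_ident D inD(1)]
      topological_tendstoD[OF filterlim_ident N(1,2)]
      topological_tendstoD[OF f_lim N'(3) fU0]
      topological_tendstoD[OF p_lim D inD(2)] topological_tendstoD[OF p_lim N(3) W]
    by (intro eventually_conj)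
  have "\<forall>\<^sub>F U in nhds U0. ?p U = Phi U"
    using ev_ne ev_j ev_below ev_above ev_D
  proof eventually_elim
    case (elim U)
    then have "f (?p U) = f U" using N'(4) by auto
    then have "lax_shock D f lam U (?p U)"
      unfolding lax_shock_def using elim j(1) by blast
    then show ?case using uniq elim by blast
  qed
  then have "(Phi \<longlongrightarrow> V0) (nhds U0)"
    by (rule Lim_transform_eventually[OF p_lim])
  then show ?thesis by (simp add: isCont_def V0_def tendsto_at_iff_tendsto_nhds)
qed

text \<open>Once \<open>Phi U\<close> is known to stay near \<open>Phi U0\<close>, the Rankine-Hugoniot condition \<open>f (Phi U) = f U\<close>
  and the bilipschitz bounds of \<open>f\<close> near both states give the Lipschitz bound.\<close>

lemma jump_operator_lipschitz:
  fixes f :: "real^'n \<Rightarrow> real^'n"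
  assumes D: "open D" and hyp: "strictly_hyperbolic D f lam"
    and jump: "jump_operator_near D f lam Phi U0"
    and reg0: "C11_diffeo_near f U0" and reg1: "C11_diffeo_near f (Phi U0)"
  obtains r L where "r > 0" "L \<ge> 0"
    "\<And>U V. U \<in> ball U0 r \<Longrightarrow> V \<in> ball U0 r \<Longrightarrow> norm (Phi U - Phi V) \<le> L * norm (U - V)"
proof -
  obtain N where N: "open N" "U0 \<in> N" "\<And>U. U \<in> N \<Longrightarrow> f (Phi U) = f U"
    using jump unfolding jump_operator_near_def lax_shock_def by metis
  obtain r0 K0 where 0: "r0 > 0" "K0 \<ge> 0" "\<And>u v. u \<in> ball U0 r0 \<Longrightarrow> v \<in> ball U0 r0 \<Longrightarrow>
       norm (f u - f v) \<le> K0 * norm (u - v) \<and> norm (u - v) \<le> K0 * norm (f u - f v)"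
    using C11_diffeo_bilipschitz[OF reg0] by metis
  obtain r1 K1 where 1: "r1 > 0" "K1 \<ge> 0" "\<And>u v. u \<in> ball (Phi U0) r1 \<Longrightarrow> v \<in> ball (Phi U0) r1 \<Longrightarrow>
       norm (f u - f v) \<le> K1 * norm (u - v) \<and> norm (u - v) \<le> K1 * norm (f u - f v)"
    using C11_diffeo_bilipschitz[OF reg1] by metis
  obtain d where d: "d > 0" "\<And>U. dist U U0 < d \<Longrightarrow> dist (Phi U) (Phi U0) < r1"
    using jump_operator_continuous[OF assms] 1(1) unfolding continuous_at_eps_delta by metis
  obtain d' where d': "d' > 0" "ball U0 d' \<subseteq> N" using N open_contains_ball by blast
  show thesis
  proof (rule that[of "min r0 (min d d')" "K1 * K0"])
    fix U V assume UV: "U \<in> ball U0 (min r0 (min d d'))" "V \<in> ball U0 (min r0 (min d d'))"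
    then have "Phi U \<in> ball (Phi U0) r1" "Phi V \<in> ball (Phi U0) r1"
      using d(2)[of U] d(2)[of V] by (auto simp: dist_commute)
    then have "norm (Phi U - Phi V) \<le> K1 * norm (f (Phi U) - f (Phi V))"
      using 1(3) by blast
    also have "f (Phi U) = f U" using N(3) UV d'(2) by auto
    also have "f (Phi V) = f V" using N(3) UV d'(2) by auto
    also have "K1 * norm (f U - f V) \<le> K1 * (K0 * norm (U - V))"
      using 0(3)[of U V] UV 1(2) by (intro mult_left_mono) auto
    finally show "norm (Phi U - Phi V) \<le> K1 * K0 * norm (U - V)" by (simp add: mult.assoc)
  qed (use 0 1 d d' in auto)
qed

section \<open>Smooth solutions near a reference solution\<close>

text \<open>Gronwall's inequality in both directions of \<open>x\<close>: the functions \<open>exp (\<mp>2 * K * x) * (norm (g x))\<^sup>2\<close>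
  are monotone.\<close>

lemma norm_le_exp_of_derivative_le:
  fixes g :: "real \<Rightarrow> 'a::real_inner"
  assumes cont: "continuous_on {p..q} g"
    and deriv: "\<And>x. x \<in> {p<..<q} \<Longrightarrow> (g has_vector_derivative g' x) (at x)"
    and bound: "\<And>x. x \<in> {p<..<q} \<Longrightarrow> norm (g' x) \<le> K * norm (g x)"
    and x: "x0 \<in> {p..q}" "x \<in> {p..q}"
  shows "norm (g x) \<le> exp (K * \<bar>x - x0\<bar>) * norm (g x0)"
proof -
  define h where "h c t = exp (c * t) * (g t \<bullet> g t)" for c t
  have h_deriv: "DERIV (h c) t :> exp (c * t) * (c * (g t \<bullet> g t) + 2 * (g t \<bullet> g' t))"
    if "t \<in> {p<..<q}" for c t
  proof -
    have "((\<lambda>t. g t \<bullet> g t) has_derivative (\<lambda>s. g t \<bullet> (s *\<^sub>R g' t) + (s *\<^sub>R g' t) \<bullet> g t)) (at t)"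
      using deriv[OF that] unfolding has_vector_derivative_def
      by (intro has_derivative_inner)
    then have "((\<lambda>t. g t \<bullet> g t) has_real_derivative 2 * (g t \<bullet> g' t)) (at t)"
      by (rule has_derivative_imp_has_field_derivative) (simp add: inner_commute)
    then have "DERIV (h c) t :> exp (c * t) * c * (g t \<bullet> g t) + exp (c * t) * (2 * (g t \<bullet> g' t))"
      unfolding h_def by (auto intro!: derivative_eq_intros)
    then show ?thesis by (simp add: algebra_simps)
  qed
  have h_cont: "continuous_on {u..v} (h c)" if "p \<le> u" "v \<le> q" for u v c
    unfolding h_def
    by (intro continuous_intros continuous_on_subset[OF cont]) (use that in auto)
  have gg': "\<bar>g t \<bullet> g' t\<bar> \<le> K * (g t \<bullet> g t)" if "t \<in> {p<..<q}" for t
  proof -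
    have "\<bar>g t \<bullet> g' t\<bar> \<le> norm (g t) * norm (g' t)" by (rule Cauchy_Schwarz_ineq2)
    also have "\<dots> \<le> norm (g t) * (K * norm (g t))"
      using bound[OF that] by (intro mult_left_mono) auto
    finally show ?thesis by (simp add: dot_square_norm power2_eq_square algebra_simps)
  qed
  have sq: "(norm (g x))\<^sup>2 \<le> (exp (K * \<bar>x - x0\<bar>) * norm (g x0))\<^sup>2"
  proof (cases "x0 \<le> x")
    case True
    have "h (-2 * K) x \<le> h (-2 * K) x0"
    proof (rule DERIV_nonpos_imp_decreasing_open[OF True])
      fix t assume "x0 < t" "t < x"
      then have t: "t \<in> {p<..<q}" using x by auto
      then have "exp (-2 * K * t) * (-2 * K * (g t \<bullet> g t) + 2 * (g t \<bullet> g' t)) \<le> 0"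
        using gg'[OF t] by (intro mult_nonneg_nonpos) auto
      then show "\<exists>y. DERIV (h (-2 * K)) t :> y \<and> y \<le> 0" using h_deriv[OF t] by blast
    qed (use h_cont x in auto)
    then have "exp (2 * K * x) * (exp (-2 * K * x) * (g x \<bullet> g x))
        \<le> exp (2 * K * x) * (exp (-2 * K * x0) * (g x0 \<bullet> g x0))"
      unfolding h_def by (intro mult_left_mono) auto
    moreover have "exp (2 * K * x) * exp (-2 * K * x) = 1"
      "exp (2 * K * x) * exp (-2 * K * x0) = exp (2 * (K * (x - x0)))"
      unfolding exp_add[symmetric] by (simp_all add: algebra_simps)
    ultimately have "g x \<bullet> g x \<le> exp (2 * (K * (x - x0))) * (g x0 \<bullet> g x0)"
      by (simp only: mult.assoc[symmetric] mult_1)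
    then show ?thesis
      using True by (simp add: dot_square_norm power_mult_distrib exp_double)
  next
    case False
    have "h (2 * K) x \<le> h (2 * K) x0"
    proof (rule DERIV_nonneg_imp_increasing_open[of x x0 "h (2 * K)"])
      fix t assume "x < t" "t < x0"
      then have t: "t \<in> {p<..<q}" using x by auto
      then have "exp (2 * K * t) * (2 * K * (g t \<bullet> g t) + 2 * (g t \<bullet> g' t)) \<ge> 0"
        using gg'[OF t] by (intro mult_nonneg_nonneg) auto
      then show "\<exists>y. DERIV (h (2 * K)) t :> y \<and> y \<ge> 0" using h_deriv[OF t] by blast
    qed (use h_cont x False in auto)
    then have "exp (-2 * K * x) * (exp (2 * K * x) * (g x \<bullet> g x))
        \<le> exp (-2 * K * x) * (exp (2 * K * x0) * (g x0 \<bullet> g x0))"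
      unfolding h_def by (intro mult_left_mono) auto
    moreover have "exp (-2 * K * x) * exp (2 * K * x) = 1"
      "exp (-2 * K * x) * exp (2 * K * x0) = exp (2 * (K * (x0 - x)))"
      unfolding exp_add[symmetric] by (simp_all add: algebra_simps)
    ultimately have "g x \<bullet> g x \<le> exp (2 * (K * (x0 - x))) * (g x0 \<bullet> g x0)"
      by (simp only: mult.assoc[symmetric] mult_1)
    then show ?thesis
      using False by (simp add: dot_square_norm power_mult_distrib exp_double)
  qed
  then show ?thesis by (rule power2_le_imp_le) simp
qed

text \<open>At a first point where \<open>\<phi>\<close> reaches \<open>r\<close>, the intermediate value theorem yields an earlier point with
  a value strictly between \<open>B\<close> and \<open>r\<close>, up to which the hypothesis of \<open>step\<close> still holds.\<close>

lemma continuation_forward: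
  fixes \<phi> :: "real \<Rightarrow> real"
  assumes cont: "continuous_on {p..q} \<phi>" and init: "\<phi> p < r" and B: "B < r"
    and step: "\<And>x. x \<in> {p..q} \<Longrightarrow> (\<forall>t\<in>{p..x}. \<phi> t < r) \<Longrightarrow> \<phi> x \<le> B"
    and x: "x \<in> {p..q}"
  shows "\<phi> x \<le> B"
proof (cases "\<forall>t\<in>{p..q}. \<phi> t < r")
  case True
  then show ?thesis using step x by auto
next
  case False
  define S where "S = {p..q} \<inter> \<phi> -` {r..}"
  have "closed S" unfolding S_def
    by (intro continuous_closed_preimage[OF cont] closed_atLeastAtMost closed_atLeast)
  then have "compact S" unfolding compact_eq_bounded_closed S_def
    by (meson bounded_closed_interval bounded_subset inf_le1)
  moreover have "S \<noteq> {}" using False by (auto simp: S_def not_less)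
  ultimately obtain m where m: "m \<in> S" "\<And>t. t \<in> S \<Longrightarrow> m \<le> t"
    using compact_attains_inf by metis
  then have mr: "r \<le> \<phi> m" "p \<le> m" "m \<le> q" by (auto simp: S_def)
  define c where "c = (max B (\<phi> p) + r) / 2"
  have c: "B < c" "\<phi> p < c" "c < r" using B init by (auto simp: c_def max_def)
  obtain t where t: "p \<le> t" "t \<le> m" "\<phi> t = c"
    using IVT'[of \<phi> p c m] c mr continuous_on_subset[OF cont, of "{p..m}"] by auto
  have "t < m" using t c mr by (cases "t = m") auto
  have "\<phi> s < r" if "s \<in> {p..t}" for s
    using m(2)[of s] that \<open>t < m\<close> mr by (force simp: S_def)
  then have "\<phi> t \<le> B" using step[of t] t mr by auto
  then show ?thesis using t c by simp
qed

text \<open>Estimates valid as long as a solution remains in a tube (\<open>\<phi> < r\<close>) become unconditional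
  if they are strong enough to keep it there (\<open>B < r\<close>).\<close>

lemma continuation:
  fixes \<phi> :: "real \<Rightarrow> real"
  assumes cont: "continuous_on {p..q} \<phi>" and x0: "x0 \<in> {p..q}" and init: "\<phi> x0 < r" and B: "B < r"
    and step: "\<And>x. x \<in> {p..q} \<Longrightarrow> (\<forall>t\<in>closed_segment x0 x. \<phi> t < r) \<Longrightarrow> \<phi> x \<le> B"
    and x: "x \<in> {p..q}"
  shows "\<phi> x \<le> B"
proof (cases "x0 \<le> x")
  case True
  show ?thesis
  proof (rule continuation_forward[of x0 q \<phi> r B])
    show "continuous_on {x0..q} \<phi>" using cont by (rule continuous_on_subset) (use x0 in auto)
    show "\<phi> y \<le> B" if "y \<in> {x0..q}" "\<forall>t\<in>{x0..y}. \<phi> t < r" for y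
      using step[of y] that x0 by (auto simp: closed_segment_eq_real_ivl)
  qed (use init B x True in auto)
next
  case False
  have "(\<phi> \<circ> uminus) (- x) \<le> B"
  proof (rule continuation_forward[of "- x0" "- p" "\<phi> \<circ> uminus" r B])
    show "continuous_on {- x0..- p} (\<phi> \<circ> uminus)"
    proof (rule continuous_on_compose)
      show "continuous_on (uminus ` {- x0..- p}) \<phi>"
        using cont by (rule continuous_on_subset) (use x0 in auto)
    qed (intro continuous_intros)
    show "(\<phi> \<circ> uminus) y \<le> B" if y: "y \<in> {- x0..- p}" "\<forall>t\<in>{- x0..y}. (\<phi> \<circ> uminus) t < r" for y
    proof -
      have "\<phi> t < r" if "t \<in> {- y..x0}" for t
        using y(2)[rule_format, of "- t"] that by simp
      then show ?thesis
        using step[of "- y"] y(1) x0 by (auto simp: closed_segment_eq_real_ivl)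
    qed
  qed (use init B x False in auto)
  then show ?thesis by simp
qed

lemma smooth_solution_subinterval:
  assumes "smooth_solution D f a p q U" and "p \<le> p'" "q' \<le> q"
  shows "smooth_solution D f a p' q' U"
proof -
  have sub: "{p'..q'} \<subseteq> {p..q}" "{p'<..<q'} \<subseteq> {p<..<q}" using assms by auto
  obtain U' where U': "continuous_on {p..q} U'"
    "\<And>x. x \<in> {p..q} \<Longrightarrow> (U has_vector_derivative U' x) (at x within {p..q})"
    using assms(1) unfolding smooth_solution_def by blast
  have "continuous_on {p'..q'} U' \<and>
      (\<forall>x\<in>{p'..q'}. (U has_vector_derivative U' x) (at x within {p'..q'}))"
    using U' sub continuous_on_subset has_vector_derivative_within_subset by blast
  then show ?thesis
    using assms(1) sub unfolding smooth_solution_def by blast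
qed

lemma smooth_solution_cong:
  assumes U: "smooth_solution D f a p q U" and eq: "\<And>x. x \<in> {p..q} \<Longrightarrow> U x = V x"
  shows "smooth_solution D f a p q V"
proof -
  obtain U' where U': "continuous_on {p..q} U'"
    "\<And>x. x \<in> {p..q} \<Longrightarrow> (U has_vector_derivative U' x) (at x within {p..q})"
    using U unfolding smooth_solution_def by blast
  have "(V has_vector_derivative U' x) (at x within {p..q})" if "x \<in> {p..q}" for x
    using has_vector_derivative_transform[OF that _ U'(2)[OF that], of V] eq by simp
  moreover have "((\<lambda>t. f (V t)) has_vector_derivative a (V x) x) (at x)" if x: "x \<in> {p<..<q}" for x
  proof -
    have "((\<lambda>t. f (U t)) has_vector_derivative a (U x) x) (at x)"
      using U x unfolding smooth_solution_def by blast
    then have "((\<lambda>t. f (V t)) has_vector_derivative a (U x) x) (at x)"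
      by (rule has_vector_derivative_transform_within_open[where S = "{p<..<q}"]) (use x eq in auto)
    then show ?thesis using eq[of x] x by simp
  qed
  moreover have "V ` {p..q} \<subseteq> D" using U eq unfolding smooth_solution_def by force
  ultimately show ?thesis
    unfolding smooth_solution_def using U'(1) by blast
qed

lemma smooth_solution_continuous:
  assumes "smooth_solution D f a p q U"
  shows "continuous_on {p..q} U"
  using assms has_vector_derivative_continuous
  unfolding smooth_solution_def continuous_on_eq_continuous_within by blast

locale steady_system =
  fixes D :: "(real^'n::finite) set" and f :: "real^'n \<Rightarrow> real^'n"
    and a :: "real^'n \<Rightarrow> real \<Rightarrow> real^'n" and xL xR :: real
  assumes open_D: "open D" and differentiable_f: "\<And>U. U \<in> D \<Longrightarrow> f differentiable (at U)"
begin

text \<open>The constants that an estimate along a trajectory consumes, collected at one point \<open>(z, x)\<close>. The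
  differential equation is treated in the variable \<open>f U\<close>, so difference quotients
  of \<open>f\<close> and \<open>a\<close> are what has to be bounded.\<close>

definition local_bounds :: "real \<Rightarrow> real \<Rightarrow> real^'n \<Rightarrow> real \<Rightarrow> bool" where
  "local_bounds r K z x \<longleftrightarrow>
     (\<forall>u v t. norm (u - z) < r \<longrightarrow> norm (v - z) < r \<longrightarrow> \<bar>t - x\<bar> < r \<longrightarrow> t \<in> {xL..xR} \<longrightarrow>
        norm (u - v) \<le> K * norm (f u - f v) \<and> norm (f u - f v) \<le> K * norm (u - v) \<and>
        norm (a u t - a v t) \<le> K * norm (u - v) \<and> norm (a u t) \<le> K)"

lemma local_boundsD:
  assumes "local_bounds r K z x" "norm (u - z) < r" "norm (v - z) < r" "\<bar>t - x\<bar> < r" "t \<in> {xL..xR}"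
  shows "norm (u - v) \<le> K * norm (f u - f v)" "norm (f u - f v) \<le> K * norm (u - v)"
    "norm (a u t - a v t) \<le> K * norm (u - v)" "norm (a u t) \<le> K"
  using assms unfolding local_bounds_def by blast+

lemma local_bounds_mono:
  assumes "local_bounds r K z x" "r' \<le> r" "K \<le> K'"
  shows "local_bounds r' K' z x"
proof -
  have "K * norm y \<le> K' * norm y" for y :: "real^'n"
    using assms(3) by (rule mult_right_mono) simp
  then show ?thesis
    using assms unfolding local_bounds_def by (meson order_less_le_trans order_trans)
qed

lemma local_bounds_shift:
  assumes "local_bounds r K z x" "norm (z' - z) \<le> d" "\<bar>x' - x\<bar> \<le> d"
  shows "local_bounds (r - d) K z' x'"
proof -
  have "norm (u - z) < r" if "norm (u - z') < r - d" for u
    using norm_triangle_ineq[of "u - z'" "z' - z"] that assms(2) by simp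
  moreover have "\<bar>t - x\<bar> < r" if "\<bar>t - x'\<bar> < r - d" for t
    using that assms(3) by linarith
  ultimately show ?thesis using assms(1) unfolding local_bounds_def by blast
qed

lemma local_bounds_exists:
  assumes z: "z \<in> D" and x: "x \<in> {xL..xR}" and f: "C11_diffeo_near f z"
    and a: "lipschitz_near (D \<times> {xL..xR}) (\<lambda>(V, t). a V t) (z, x)"
  obtains r K where "r > 0" "local_bounds r K z x"
proof -
  obtain r1 K1 where 1: "r1 > 0" "K1 \<ge> 0" "\<And>u v. u \<in> ball z r1 \<Longrightarrow> v \<in> ball z r1 \<Longrightarrow>
       norm (f u - f v) \<le> K1 * norm (u - v) \<and> norm (u - v) \<le> K1 * norm (f u - f v)"
    using C11_diffeo_bilipschitz[OF f] by metis
  obtain r2 L where 2: "r2 > 0" "L-lipschitz_on (ball (z, x) r2 \<inter> D \<times> {xL..xR}) (\<lambda>(V, t). a V t)"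
    using a unfolding lipschitz_near_def by blast
  have L0: "L \<ge> 0" using 2(2) by (rule lipschitz_on_nonneg)
  obtain r3 where 3: "r3 > 0" "ball z r3 \<subseteq> D" using z open_D open_contains_ball by blast
  define r where "r = Min {r1, r2 / 2, r3}"
  define K where "K = max K1 (max L (norm (a z x) + L * r2))"
  have r: "r > 0" "r \<le> r1" "r \<le> r2 / 2" "r \<le> r3" using 1 2 3 by (auto simp: r_def)
  have K: "K1 \<le> K" "L \<le> K" "norm (a z x) + L * r2 \<le> K" by (auto simp: K_def)
  have in2: "(u, t) \<in> ball (z, x) r2 \<inter> D \<times> {xL..xR}"
    if "norm (u - z) < r" "\<bar>t - x\<bar> < r" "t \<in> {xL..xR}" for u t
  proof -
    have "dist (z, x) (u, t) \<le> dist z u + dist x t"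
      using sqrt_sum_squares_le_sum[of "dist z u" "dist x t"] by (simp add: dist_Pair_Pair)
    also have "\<dots> < r2" using that r by (auto simp: dist_norm norm_minus_commute)
    finally have "(u, t) \<in> ball (z, x) r2" by simp
    moreover have "u \<in> D" using that r 3(2) by (auto simp: subset_iff dist_norm norm_minus_commute)
    ultimately show ?thesis using that by simp
  qed
  have "local_bounds r K z x"
    unfolding local_bounds_def
  proof (intro allI impI conjI)
    fix u v t
    assume u: "norm (u - z) < r" and v: "norm (v - z) < r" and t: "\<bar>t - x\<bar> < r" "t \<in> {xL..xR}"
    have "norm (f u - f v) \<le> K1 * norm (u - v) \<and> norm (u - v) \<le> K1 * norm (f u - f v)"
      using 1(3)[of u v] u v r by (auto simp: dist_norm norm_minus_commute)
    moreover have "K1 * norm y \<le> K * norm y" for y :: "real^'n" using K(1) by (rule mult_right_mono) simp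
    ultimately show "norm (u - v) \<le> K * norm (f u - f v)" "norm (f u - f v) \<le> K * norm (u - v)"
      by (meson order_trans)+
    have "norm (a u t - a v t) \<le> L * norm (u - v)"
      using lipschitz_onD[OF 2(2) in2[OF u t] in2[OF v t]] by (simp add: dist_norm dist_Pair_Pair)
    also have "\<dots> \<le> K * norm (u - v)" using K(2) by (rule mult_right_mono) simp
    finally show "norm (a u t - a v t) \<le> K * norm (u - v)" .
    have "norm (a u t - a z x) \<le> L * dist (u, t) (z, x)"
      using lipschitz_onD[OF 2(2) in2[OF u t], of "(z, x)"] 2(1) z x by (simp add: dist_norm)
    also have "\<dots> \<le> L * r2"
      using in2[OF u t] L0 by (intro mult_left_mono) (auto simp: dist_commute)
    finally show "norm (a u t) \<le> K"
      using K(3) norm_triangle_ineq2[of "a u t" "a z x"] by linarith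
  qed
  then show thesis using that r(1) by blast
qed

text \<open>Compactness of the trajectory: local bounds hold with the same constants at neighbouring points,
  and finitely many such neighbourhoods suffice.\<close>

lemma local_bounds_uniform:
  assumes cont: "continuous_on {p..q} U"
    and loc: "\<And>x. x \<in> {p..q} \<Longrightarrow> \<exists>r>0. \<exists>K. local_bounds r K (U x) x"
  obtains r K where "r > 0" "K \<ge> 1" "\<And>x. x \<in> {p..q} \<Longrightarrow> local_bounds r K (U x) x"
proof -
  have "\<exists>d r K. 0 < d \<and> 0 < r \<and> (\<forall>x'\<in>{p..q}. dist x' x < d \<longrightarrow> local_bounds r K (U x') x')"
    if x: "x \<in> {p..q}" for x
  proof -
    obtain r K where r: "r > 0" "local_bounds r K (U x) x" using loc[OF x] by blast
    obtain d where d: "d > 0" "\<And>x'. x' \<in> {p..q} \<Longrightarrow> dist x' x < d \<Longrightarrow> dist (U x') (U x) < r / 2"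
      using cont x r(1) unfolding continuous_on_iff by (meson half_gt_zero)
    have "local_bounds (r / 2) K (U x') x'" if "x' \<in> {p..q}" "dist x' x < min d (r / 2)" for x'
      using local_bounds_shift[OF r(2), of "U x'" "r / 2" x'] d(2)[of x'] that
      by (simp add: dist_norm)
    moreover have "0 < min d (r / 2)" "0 < r / 2" using d(1) r(1) by auto
    ultimately show ?thesis by blast
  qed
  then obtain d r K where dr: "\<And>x. x \<in> {p..q} \<Longrightarrow> 0 < d x \<and> 0 < r x \<and>
      (\<forall>x'\<in>{p..q}. dist x' x < d x \<longrightarrow> local_bounds (r x) (K x) (U x') x')"
    by metis
  obtain C where C: "C \<subseteq> {p..q}" "finite C" "{p..q} \<subseteq> (\<Union>x\<in>C. ball x (d x))"
  proof (rule compactE_image[of "{p..q}" "{p..q}" "\<lambda>x. ball x (d x)"])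
    show "{p..q} \<subseteq> (\<Union>x\<in>{p..q}. ball x (d x))" using dr by force
  qed auto
  define r0 where "r0 = Min (insert 1 (r ` C))"
  define K0 where "K0 = Max (insert 1 (K ` C))"
  show thesis
  proof (rule that[of r0 K0])
    show "0 < r0" unfolding r0_def using C dr by (subst Min_gr_iff) auto
    show "1 \<le> K0" unfolding K0_def using C(2) by (intro Max_ge) auto
    fix x assume x: "x \<in> {p..q}"
    then obtain y where y: "y \<in> C" "dist x y < d y" using C(3) by (auto simp: dist_commute)
    then have "local_bounds (r y) (K y) (U x) x" using dr C(1) x by blast
    moreover have "r0 \<le> r y" unfolding r0_def using C(2) y by (intro Min_le) auto
    moreover have "K y \<le> K0" unfolding K0_def using C(2) y by (intro Max_ge) auto
    ultimately show "local_bounds r0 K0 (U x) x" by (rule local_bounds_mono)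
  qed
qed

lemma continuous_flux:
  assumes "smooth_solution D f a p q U"
  shows "continuous_on {p..q} (\<lambda>x. f (U x))"
proof (rule continuous_on_compose2[OF _ smooth_solution_continuous[OF assms]])
  show "continuous_on D f"
    using differentiable_f differentiable_imp_continuous_within
    by (intro continuous_at_imp_continuous_on) blast
  show "U ` {p..q} \<subseteq> D" using assms unfolding smooth_solution_def by blast
qed

text \<open>Gronwall's factor for \<open>f U\<close> on the whole interval, times one factor \<open>K\<close> each for the passage from
  \<open>U\<close> to \<open>f U\<close> and back.\<close>

definition growth :: "real \<Rightarrow> real" where
  "growth K = K\<^sup>2 * exp (K\<^sup>2 * (xR - xL))"

lemma growth_ge_1: "K \<ge> 1 \<Longrightarrow> xL \<le> xR \<Longrightarrow> 1 \<le> growth K"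
  unfolding growth_def by (smt (verit) mult_le_cancel_left1 one_le_exp_iff one_le_power zero_le_mult_iff
      zero_le_power2)

text \<open>While \<open>V\<close> is in the tube around \<open>U\<close>, the difference of \<open>f V\<close> and \<open>f U\<close> satisfies Gronwall's
  hypothesis; the resulting bound keeps \<open>V\<close> in the tube. Closeness at the single point \<open>x0\<close>
  thus spreads over the interval: with equal values at \<open>x0\<close> this is uniqueness among all smooth
  solutions, and it turns closeness in the mean into uniform closeness.\<close>

lemma smooth_solutions_stay_close:
  assumes U: "smooth_solution D f a p q U" and V: "smooth_solution D f a p q V"
    and pq: "xL \<le> p" "q \<le> xR" and K: "K \<ge> 1"
    and tube: "\<And>x. x \<in> {p..q} \<Longrightarrow> local_bounds r K (U x) x"
    and x0: "x0 \<in> {p..q}" and close: "growth K * norm (V x0 - U x0) < r"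
    and x: "x \<in> {p..q}"
  shows "norm (V x - U x) \<le> growth K * norm (V x0 - U x0)"
proof (rule continuation[where \<phi> = "\<lambda>x. norm (V x - U x)" and p = p and q = q and ?x0.0 = x0 and r = r])
  show "continuous_on {p..q} (\<lambda>x. norm (V x - U x))"
    using smooth_solution_continuous[OF U] smooth_solution_continuous[OF V]
    by (intro continuous_intros)
  have "1 * norm (V x0 - U x0) \<le> growth K * norm (V x0 - U x0)"
    using growth_ge_1[OF K] pq x0 by (intro mult_right_mono) auto
  then show "norm (V x0 - U x0) < r" using close by linarith
  then have r0: "r > 0" using norm_ge_zero[of "V x0 - U x0"] by linarith
  fix x assume x: "x \<in> {p..q}" and seg: "\<forall>t\<in>closed_segment x0 x. norm (V t - U t) < r"
  define p' q' where "p' = min x0 x" and "q' = max x0 x"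
  have seg': "norm (V t - U t) < r" if "t \<in> {p'..q'}" for t
    using seg that by (auto simp: closed_segment_eq_real_ivl p'_def q'_def split: if_splits)
  have sub: "p \<le> p'" "q' \<le> q" "x0 \<in> {p'..q'}" "x \<in> {p'..q'}"
    using x x0 by (auto simp: p'_def q'_def)
  note U' = smooth_solution_subinterval[OF U sub(1,2)]
  note V' = smooth_solution_subinterval[OF V sub(1,2)]
  have bounds: "norm (V t - U t) \<le> K * norm (f (V t) - f (U t))"
      "norm (f (V t) - f (U t)) \<le> K * norm (V t - U t)"
      "norm (a (V t) t - a (U t) t) \<le> K * norm (V t - U t)"
    if t: "t \<in> {p'..q'}" for t
  proof -
    have tt: "t \<in> {p..q}" "t \<in> {xL..xR}" using t sub pq by auto
    note lb = tube[OF tt(1)]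
    show "norm (V t - U t) \<le> K * norm (f (V t) - f (U t))"
      "norm (f (V t) - f (U t)) \<le> K * norm (V t - U t)"
      "norm (a (V t) t - a (U t) t) \<le> K * norm (V t - U t)"
      by (rule local_boundsD[OF lb seg'[OF t], of "U t" t]; use r0 tt in simp)+
  qed
  have "norm (f (V x) - f (U x)) \<le> exp (K\<^sup>2 * \<bar>x - x0\<bar>) * norm (f (V x0) - f (U x0))"
  proof (rule norm_le_exp_of_derivative_le[where g = "\<lambda>x. f (V x) - f (U x)" and p = p' and q = q'])
    show "continuous_on {p'..q'} (\<lambda>x. f (V x) - f (U x))"
      by (intro continuous_on_diff continuous_flux U' V')
    fix t assume t: "t \<in> {p'<..<q'}"
    show "((\<lambda>x. f (V x) - f (U x)) has_vector_derivative a (V t) t - a (U t) t) (at t)"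
      using U' V' t unfolding smooth_solution_def by (intro has_vector_derivative_diff) auto
    have "norm (a (V t) t - a (U t) t) \<le> K * norm (V t - U t)" using bounds[of t] t by simp
    also have "\<dots> \<le> K * (K * norm (f (V t) - f (U t)))"
      using bounds[of t] t K by (intro mult_left_mono) auto
    finally show "norm (a (V t) t - a (U t) t) \<le> K\<^sup>2 * norm (f (V t) - f (U t))"
      by (simp add: power2_eq_square mult.assoc)
  qed (use sub in auto)
  also have "\<dots> \<le> exp (K\<^sup>2 * (xR - xL)) * (K * norm (V x0 - U x0))"
  proof (rule mult_mono)
    show "exp (K\<^sup>2 * \<bar>x - x0\<bar>) \<le> exp (K\<^sup>2 * (xR - xL))"
      using x x0 pq by (auto intro!: mult_left_mono)
    show "norm (f (V x0) - f (U x0)) \<le> K * norm (V x0 - U x0)" using bounds sub by blast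
  qed auto
  finally have "K * norm (f (V x) - f (U x)) \<le> K * (exp (K\<^sup>2 * (xR - xL)) * (K * norm (V x0 - U x0)))"
    using K by (intro mult_left_mono) auto
  then show "norm (V x - U x) \<le> growth K * norm (V x0 - U x0)"
    using bounds(1)[OF sub(4)] by (simp add: growth_def power2_eq_square algebra_simps)
qed (use close x0 x in auto)

text \<open>Used where a solution extends beyond the interval of the reference solution, so that there is
  nothing to compare it with except a constant.\<close>

lemma smooth_solution_bounded_speed:
  assumes V: "smooth_solution D f a p q V" and pq: "xL \<le> p" "q \<le> xR" and K: "K \<ge> 1"
    and lb: "local_bounds r K z t0" and near: "\<And>x. x \<in> {p..q} \<Longrightarrow> \<bar>x - t0\<bar> < r"
    and x0: "x0 \<in> {p..q}" and close: "norm (V x0 - z) + K\<^sup>2 * (q - p) < r"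
    and x: "x \<in> {p..q}"
  shows "norm (V x - V x0) \<le> K\<^sup>2 * (q - p)"
proof (rule continuation[where \<phi> = "\<lambda>x. norm (V x - V x0)" and p = p and q = q and ?x0.0 = x0
      and r = "r - norm (V x0 - z)"])
  show "continuous_on {p..q} (\<lambda>x. norm (V x - V x0))"
    using smooth_solution_continuous[OF V] by (intro continuous_intros)
  have "K\<^sup>2 * (q - p) \<ge> 0" using x by auto
  then show "norm (V x0 - V x0) < r - norm (V x0 - z)" using close by simp
  fix x assume x: "x \<in> {p..q}" and seg: "\<forall>t\<in>closed_segment x0 x. norm (V t - V x0) < r - norm (V x0 - z)"
  define p' q' where "p' = min x0 x" and "q' = max x0 x"
  have inball: "norm (V t - z) < r" if "t \<in> {p'..q'}" for t
  proof -
    have "norm (V t - V x0) < r - norm (V x0 - z)"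
      using seg that by (auto simp: closed_segment_eq_real_ivl p'_def q'_def split: if_splits)
    then show ?thesis using norm_triangle_ineq[of "V t - V x0" "V x0 - z"] by simp
  qed
  have sub: "p \<le> p'" "q' \<le> q" "x0 \<in> {p'..q'}" "x \<in> {p'..q'}"
    using x x0 by (auto simp: p'_def q'_def)
  note V' = smooth_solution_subinterval[OF V sub(1,2)]
  have ends: "norm (f (V q') - f (V p')) \<le> K * (q' - p')"
  proof (cases "p' < q'")
    case True
    obtain t where t: "t \<in> {p'<..<q'}" "norm (f (V q') - f (V p')) \<le> norm ((q' - p') *\<^sub>R a (V t) t)"
      using mvt_general[OF True continuous_flux[OF V'], of "\<lambda>t s. s *\<^sub>R a (V t) t"] V'
      unfolding smooth_solution_def has_vector_derivative_def by auto
    have "t \<in> {p..q}" using t(1) sub by auto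
    then have "norm (a (V t) t) \<le> K"
      using local_boundsD(4)[OF lb inball[of t] inball[of t] near, of t] t(1) pq by auto
    then have "norm ((q' - p') *\<^sub>R a (V t) t) \<le> K * (q' - p')"
      using True by (simp add: mult.commute mult_left_mono)
    then show ?thesis using t(2) by linarith
  next
    case False
    then have "p' = q'" by (auto simp: p'_def q'_def)
    then show ?thesis by simp
  qed
  have "norm (V x - V x0) = norm (V q' - V p')"
    by (cases "x0 \<le> x") (auto simp: p'_def q'_def norm_minus_commute max_def min_def)
  also have "\<dots> \<le> K * norm (f (V q') - f (V p'))"
    using sub pq near[of p'] by (intro local_boundsD(1)[OF lb, of _ _ p'] inball) auto
  also have "\<dots> \<le> K * (K * (q' - p'))"
    using ends K by (intro mult_left_mono) auto
  also have "\<dots> \<le> K * (K * (q - p))"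
    using sub K by (intro mult_left_mono) auto
  finally show "norm (V x - V x0) \<le> K\<^sup>2 * (q - p)" by (simp add: power2_eq_square mult.assoc)
qed (use close x0 x in auto)

text \<open>The description operator in \<open>evolution\<close> is resolved by uniqueness for the initial value problem.\<close>

lemma evolution_eq:
  assumes U: "smooth_solution D f a p q U" and pq: "xL \<le> p" "p \<le> q" "q \<le> xR"
    and K: "K \<ge> 1" and r: "r > 0"
    and tube: "\<And>x. x \<in> {p..q} \<Longrightarrow> local_bounds r K (U x) x"
  shows "evolution D f a p q (U p) = U q"
  unfolding evolution_def
proof (rule the_equality)
  show "\<exists>V. smooth_solution D f a p q V \<and> V p = U p \<and> V q = U q" using U by blast
  fix v assume "\<exists>V. smooth_solution D f a p q V \<and> V p = U p \<and> V q = v"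
  then obtain V where V: "smooth_solution D f a p q V" "V p = U p" "V q = v" by blast
  then show "v = U q"
    using smooth_solutions_stay_close[OF U V(1) pq(1,3) K tube, of p q] pq r by simp
qed

text \<open>The intervals of the two solutions differ by a small amount, as for two solutions whose
  shocks are displaced. On the common part the solutions stay close, and outside it the reference
  value is frozen at the end point.\<close>

lemma clamped_comparison:
  assumes U: "smooth_solution D f a p q U" and V: "smooth_solution D f a p' q' V"
    and pq: "xL \<le> p" "q \<le> xR" "xL \<le> p'" "q' \<le> xR" and ov: "max p p' \<le> min q q'"
    and K: "K \<ge> 1"
    and tube: "\<And>x. x \<in> {p..q} \<Longrightarrow> local_bounds r K (U x) x"
    and d: "\<bar>p - p'\<bar> \<le> \<delta>" "\<bar>q - q'\<bar> \<le> \<delta>" and x1: "x1 \<in> {p..q} \<inter> {p'..q'}"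
    and \<theta>: "norm (V x1 - U x1) \<le> \<theta>" and small: "growth K * \<theta> + K\<^sup>2 * \<delta> < r" "\<delta> < r"
    and x: "x \<in> {p'..q'}"
  shows "norm (V x - U (max p (min x q))) \<le> growth K * \<theta> + K\<^sup>2 * \<delta>"
proof -
  let ?lo = "max p p'" and ?hi = "min q q'"
  have xLR: "xL \<le> xR" using x1 pq by auto
  have g0: "growth K \<ge> 0" using growth_ge_1[OF K xLR] by simp
  have \<delta>0: "\<delta> \<ge> 0" using d by linarith
  have K\<delta>: "K\<^sup>2 * \<delta> \<ge> 0" using \<delta>0 by simp
  have inner: "norm (V y - U y) \<le> growth K * \<theta>" if y: "y \<in> {?lo..?hi}" for y
  proof -
    have le: "growth K * norm (V x1 - U x1) \<le> growth K * \<theta>"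
      using \<theta> g0 by (rule mult_left_mono)
    have "norm (V y - U y) \<le> growth K * norm (V x1 - U x1)"
    proof (rule smooth_solutions_stay_close[of ?lo ?hi])
      show "smooth_solution D f a ?lo ?hi U" using U by (rule smooth_solution_subinterval) auto
      show "smooth_solution D f a ?lo ?hi V" using V by (rule smooth_solution_subinterval) auto
      show "growth K * norm (V x1 - U x1) < r" using le small K\<delta> by linarith
    qed (use pq K tube x1 y in auto)
    then show ?thesis using le by linarith
  qed
  have outer: "norm (V x - U e) \<le> growth K * \<theta> + K\<^sup>2 * \<delta>"
    if e: "e \<in> {?lo..?hi}" and uv: "p' \<le> u" "v \<le> q'" "e \<in> {u..v}" "x \<in> {u..v}" "v - u \<le> \<delta>" for e u v
  proof -
    have Kuv: "K\<^sup>2 * (v - u) \<le> K\<^sup>2 * \<delta>" using uv(5) by (rule mult_left_mono) simp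
    have "norm (V x - V e) \<le> K\<^sup>2 * (v - u)"
    proof (rule smooth_solution_bounded_speed[of u v V K r "U e" e])
      show "smooth_solution D f a u v V" using V uv by (intro smooth_solution_subinterval[OF V])
      show "local_bounds r K (U e) e" using tube e by auto
      show "norm (V e - U e) + K\<^sup>2 * (v - u) < r" using inner[OF e] Kuv small by linarith
      show "\<bar>y - e\<bar> < r" if "y \<in> {u..v}" for y using that uv small by auto
    qed (use pq K uv in auto)
    then show ?thesis
      using norm_triangle_ineq[of "V x - V e" "V e - U e"] inner[OF e] Kuv by simp
  qed
  consider "x < p" | "q < x" | "x \<in> {p..q}" by force
  then show ?thesis
  proof cases
    case 1
    then show ?thesis using outer[of p x p] x d ov by auto
  next
    case 2
    then show ?thesis using outer[of q q x] x d ov by auto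
  next
    case 3
    then have "norm (V x - U x) \<le> growth K * \<theta>" using inner x by auto
    then show ?thesis using 3 K\<delta> by (auto simp: max_def min_def)
  qed
qed

end

section \<open>Shock solutions close to the exact one in the mean\<close>

text \<open>The interval is left-open because a shock solution takes its left value at the shock.\<close>

lemma integral_ge_on_subinterval:
  fixes g :: "real \<Rightarrow> real"
  assumes int: "g integrable_on {p..q}" and nonneg: "\<And>x. 0 \<le> g x"
    and uv: "p \<le> u" "u \<le> v" "v \<le> q" and ge: "\<And>x. x \<in> {u<..v} \<Longrightarrow> \<theta> \<le> g x"
  shows "\<theta> * (v - u) \<le> integral {p..q} g"
proof -
  have int': "g integrable_on {u..v}"
    using int by (rule integrable_on_subinterval) (use uv in auto)
  have g': "((\<lambda>x. if x = u then \<theta> else g x) has_integral integral {u..v} g) {u..v}"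
    by (rule has_integral_spike_finite[where S = "{u}" and f = g])
      (auto intro: integrable_integral[OF int'])
  have "((\<lambda>x. \<theta>) has_integral \<theta> * (v - u)) {u..v}"
    using has_integral_const_real[of \<theta> u v] uv by (simp add: mult.commute)
  then have "\<theta> * (v - u) \<le> integral {u..v} g"
    by (rule has_integral_le[OF _ g']) (use ge in auto)
  also have "\<dots> \<le> integral {p..q} g"
    using uv int int' nonneg by (intro integral_subset_le) auto
  finally show ?thesis .
qed

lemma right_part_off_shock [simp]: "x \<noteq> c \<Longrightarrow> right_part c U x = U x"
  by (simp add: right_part_def)

lemma shock_solution_absolutely_integrable:
  assumes "shock_solution D f lam a xL xR s UL BR b y U"
  shows "U absolutely_integrable_on {xL..xR}"
proof (rule absolutely_integrable_on_combine[where c = "y $ s"])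
  show "U absolutely_integrable_on {xL..y $ s}"
    using assms unfolding shock_solution_def
    by (blast intro: absolutely_integrable_continuous_real smooth_solution_continuous)
  have "right_part (y $ s) U absolutely_integrable_on {y $ s..xR}"
    using assms unfolding shock_solution_def
    by (blast intro: absolutely_integrable_continuous_real smooth_solution_continuous)
  then show "U absolutely_integrable_on {y $ s..xR}"
    by (rule absolutely_integrable_spike[where S = "{y $ s}"]) auto
qed (use assms in \<open>auto simp: shock_solution_def\<close>)

lemma shock_solutions_distance_integrable:
  assumes "shock_solution D f lam a xL xR s UL BR b y U"
    and "shock_solution D f lam a xL xR s UL BR b' z V"
  shows "(\<lambda>x. norm (U x - V x)) integrable_on {xL..xR}"
  using set_integral_diff(1)[OF shock_solution_absolutely_integrable[OF assms(1)]
      shock_solution_absolutely_integrable[OF assms(2)]]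
  unfolding absolutely_integrable_on_def by blast

text \<open>The exact solution with tubes of uniform constants around its two branches, and with \<open>Phi\<close>
  selecting the right state of the exact shock.\<close>

locale exact_shock = steady_system D f a xL xR
  for D :: "(real^'n::finite) set" and f a xL xR +
  fixes lam :: "nat \<Rightarrow> real^'n \<Rightarrow> real" and s :: "'m::finite" and e :: "'m \<Rightarrow> 'n"
    and UL :: "real^'m \<Rightarrow> real^'n" and BR :: "real^'n \<Rightarrow> real^'j::finite"
    and Phi :: "real^'n \<Rightarrow> real^'n" and yex :: "real^'m" and Uex :: "real \<Rightarrow> real^'n"
    and r K :: real
  assumes exact: "shock_solution D f lam a xL xR s UL BR 0 yex Uex"
    and r: "r > 0" and K: "K \<ge> 1"
    and left_tube: "\<And>x. x \<in> {xL..yex $ s} \<Longrightarrow> local_bounds r K (Uex x) x"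
    and right_tube: "\<And>x. x \<in> {yex $ s..xR} \<Longrightarrow> local_bounds r K (right_part (yex $ s) Uex x) x"
    and free_components: "\<And>p i. p \<in> param_space s \<Longrightarrow> i \<noteq> s \<Longrightarrow> UL p $ e i = p $ i"
    and jump_operator: "jump_operator_near D f lam Phi (Uex (yex $ s))"
    and jump_exact: "Phi (Uex (yex $ s)) = right_part (yex $ s) Uex (yex $ s)"
begin

abbreviation "c \<equiv> yex $ s"
abbreviation "Rex \<equiv> right_part c Uex"
abbreviation "solution \<equiv> shock_solution D f lam a xL xR s UL BR"

definition jump_size :: real where "jump_size = norm (Rex c - Uex c)"

lemma c_interior: "xL < c" "c < xR" and xL_le_xR: "xL \<le> xR"
  using exact unfolding shock_solution_def by auto

lemma exact_left: "smooth_solution D f a xL c Uex"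
  and exact_right: "smooth_solution D f a c xR Rex"
  using exact unfolding shock_solution_def by auto

lemma jump_size_pos: "jump_size > 0"
  using exact unfolding shock_solution_def lax_shock_def jump_size_def by auto

lemma growth_K: "growth K \<ge> 1"
  by (rule growth_ge_1[OF K xL_le_xR])

text \<open>Uniform closeness, branch by branch. Where a branch extends beyond the exact shock position, it is
  compared with the one-sided exact state there.\<close>

definition close_to_exact :: "real \<Rightarrow> real^'m \<Rightarrow> (real \<Rightarrow> real^'n) \<Rightarrow> bool" where
  "close_to_exact \<rho> y U \<longleftrightarrow> \<bar>y $ s - c\<bar> < \<rho> \<and>
     (\<forall>x\<in>{xL..y $ s}. norm (U x - Uex (min x c)) < \<rho>) \<and>
     (\<forall>x\<in>{y $ s..xR}. norm (right_part (y $ s) U x - Rex (max x c)) < \<rho>)"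

lemma close_to_exact_mono: "close_to_exact \<rho> y U \<Longrightarrow> \<rho> \<le> \<rho>' \<Longrightarrow> close_to_exact \<rho>' y U"
  unfolding close_to_exact_def by (meson order_less_le_trans)

lemma close_to_exact_self: "\<rho> > 0 \<Longrightarrow> close_to_exact \<rho> yex Uex"
  unfolding close_to_exact_def by auto

lemma tubes_around_close_solution:
  assumes "close_to_exact \<rho> y U" and "\<rho> \<le> r / 2" and "solution b y U"
  shows "\<And>x. x \<in> {xL..y $ s} \<Longrightarrow> local_bounds (r / 2) K (U x) x"
    and "\<And>x. x \<in> {y $ s..xR} \<Longrightarrow> local_bounds (r / 2) K (right_part (y $ s) U x) x"
proof -
  have ys: "xL < y $ s" "y $ s < xR" using assms(3) unfolding shock_solution_def by auto
  have \<sigma>: "\<bar>y $ s - c\<bar> < r / 2" using assms(1,2) unfolding close_to_exact_def by auto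
  show "local_bounds (r / 2) K (U x) x" if x: "x \<in> {xL..y $ s}" for x
  proof -
    have "norm (U x - Uex (min x c)) \<le> r / 2"
      using assms(1,2) x unfolding close_to_exact_def by force
    moreover have "\<bar>x - min x c\<bar> \<le> r / 2" using x \<sigma> r by (auto simp: min_def)
    moreover have "min x c \<in> {xL..c}" using x c_interior by auto
    ultimately have "local_bounds (r - r / 2) K (U x) x"
      using left_tube local_bounds_shift by blast
    then show ?thesis by simp
  qed
  show "local_bounds (r / 2) K (right_part (y $ s) U x) x" if x: "x \<in> {y $ s..xR}" for x
  proof -
    have "norm (right_part (y $ s) U x - Rex (max x c)) \<le> r / 2"
      using assms(1,2) x unfolding close_to_exact_def by force
    moreover have "\<bar>x - max x c\<bar> \<le> r / 2" using x \<sigma> r by (auto simp: max_def)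
    moreover have "max x c \<in> {c..xR}" using x c_interior by auto
    ultimately have "local_bounds (r - r / 2) K (right_part (y $ s) U x) x"
      using right_tube local_bounds_shift by blast
    then show ?thesis by simp
  qed
qed

text \<open>The exact branches themselves change by at most \<open>K\<^sup>2 * \<rho>\<close> within distance \<open>\<rho>\<close> of the shock.\<close>

lemma close_solution_near_shock:
  assumes close: "close_to_exact \<rho> y U" and \<rho>: "K\<^sup>2 * \<rho> < r" "\<rho> < r" and sol: "solution b y U"
    and x: "\<bar>x - c\<bar> < \<rho>"
  shows "x \<in> {xL..y $ s} \<Longrightarrow> norm (U x - Uex c) < (1 + K\<^sup>2) * \<rho>"
    and "x \<in> {y $ s..xR} \<Longrightarrow> norm (right_part (y $ s) U x - Rex c) < (1 + K\<^sup>2) * \<rho>"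
proof -
  assume xl: "x \<in> {xL..y $ s}"
  have "K\<^sup>2 * (c - min x c) \<le> K\<^sup>2 * \<rho>" using x by (intro mult_left_mono) auto
  moreover have "norm (Uex (min x c) - Uex c) \<le> K\<^sup>2 * (c - min x c)"
  proof (rule smooth_solution_bounded_speed[of "min x c" c Uex K r "Uex c" c])
    show "smooth_solution D f a (min x c) c Uex"
      using exact_left by (rule smooth_solution_subinterval) (use xl c_interior in auto)
    show "norm (Uex c - Uex c) + K\<^sup>2 * (c - min x c) < r" using calculation \<rho> by simp
  qed (use xl c_interior K left_tube \<rho> x in auto)
  moreover have "norm (U x - Uex (min x c)) < \<rho>"
    using close xl unfolding close_to_exact_def by blast
  ultimately show "norm (U x - Uex c) < (1 + K\<^sup>2) * \<rho>"
    using norm_triangle_ineq[of "U x - Uex (min x c)" "Uex (min x c) - Uex c"]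
    by (simp add: distrib_right)
next
  assume xr: "x \<in> {y $ s..xR}"
  have "K\<^sup>2 * (max x c - c) \<le> K\<^sup>2 * \<rho>" using x by (intro mult_left_mono) auto
  moreover have "norm (Rex (max x c) - Rex c) \<le> K\<^sup>2 * (max x c - c)"
  proof (rule smooth_solution_bounded_speed[of c "max x c" Rex K r "Rex c" c])
    show "smooth_solution D f a c (max x c) Rex"
      using exact_right by (rule smooth_solution_subinterval) (use xr c_interior in auto)
    show "norm (Rex c - Rex c) + K\<^sup>2 * (max x c - c) < r" using calculation \<rho> by simp
  qed (use xr c_interior K right_tube \<rho> x in auto)
  moreover have "norm (right_part (y $ s) U x - Rex (max x c)) < \<rho>"
    using close xr unfolding close_to_exact_def by blast
  ultimately show "norm (right_part (y $ s) U x - Rex c) < (1 + K\<^sup>2) * \<rho>"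
    using norm_triangle_ineq[of "right_part (y $ s) U x - Rex (max x c)" "Rex (max x c) - Rex c"]
    by (simp add: distrib_right)
qed

lemma mult_le_of_le_divide:
  fixes q t :: real
  assumes "0 < q" and "t \<le> w / q" shows "q * t \<le> w"
  using assms by (simp add: pos_le_divide_eq mult.commute)

text \<open>The composition of operators defining the exact residual retraces a close shock solution:
  uniqueness for the initial value problem determines both branches, and near the exact right
  state the partner selected by \<open>Phi\<close> is the only one.\<close>

lemma exact_operators_on_close_solutions:
  obtains \<rho>0 where "\<rho>0 > 0"
    "\<And>b y U. solution b y U \<Longrightarrow> close_to_exact \<rho>0 y U \<Longrightarrow>
       evolution D f a xL (y $ s) (UL (left_params s y)) = U (y $ s) \<and>
       Phi (U (y $ s)) = right_part (y $ s) U (y $ s) \<and>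
       evolution D f a (y $ s) xR (right_part (y $ s) U (y $ s)) = U xR"
proof -
  obtain N W where N: "open N" "Uex c \<in> N" "open W"
    and NW: "\<And>U. U \<in> N \<Longrightarrow> Phi U \<in> W"
    and uniq: "\<And>U V. U \<in> N \<Longrightarrow> V \<in> W \<Longrightarrow> lax_shock D f lam U V \<Longrightarrow> V = Phi U"
    using jump_operator unfolding jump_operator_near_def by metis
  have "Rex c \<in> W" using NW[OF N(2)] jump_exact by simp
  then obtain d2 where d2: "d2 > 0" "ball (Rex c) d2 \<subseteq> W" using N(3) open_contains_ball by blast
  obtain d1 where d1: "d1 > 0" "ball (Uex c) d1 \<subseteq> N" using N(1,2) open_contains_ball by blast
  define \<rho>0 where "\<rho>0 = Min {r / 2, r / (2 * K\<^sup>2), d1 / (1 + K\<^sup>2), d2 / (1 + K\<^sup>2)}"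
  have K2: "K\<^sup>2 \<ge> 1" using K by (simp add: one_le_power)
  have "0 < r / (2 * K\<^sup>2)" "0 < d1 / (1 + K\<^sup>2)" "0 < d2 / (1 + K\<^sup>2)"
    by (rule divide_pos_pos; use r d1(1) d2(1) K2 in linarith)+
  then have "\<rho>0 > 0" using r by (simp add: \<rho>0_def)
  moreover have "\<rho>0 \<le> r / 2" "\<rho>0 \<le> r / (2 * K\<^sup>2)" "\<rho>0 \<le> d1 / (1 + K\<^sup>2)" "\<rho>0 \<le> d2 / (1 + K\<^sup>2)"
    unfolding \<rho>0_def by (rule Min_le, simp, simp)+
  ultimately have \<rho>0: "\<rho>0 > 0" "\<rho>0 \<le> r / 2" "\<rho>0 \<le> r / (2 * K\<^sup>2)"
    "\<rho>0 \<le> d1 / (1 + K\<^sup>2)" "\<rho>0 \<le> d2 / (1 + K\<^sup>2)" .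
  have small: "K\<^sup>2 * \<rho>0 < r" "\<rho>0 < r" "(1 + K\<^sup>2) * \<rho>0 \<le> d1" "(1 + K\<^sup>2) * \<rho>0 \<le> d2"
    using mult_le_of_le_divide[OF _ \<rho>0(3)] mult_le_of_le_divide[OF _ \<rho>0(4)] mult_le_of_le_divide[OF _ \<rho>0(5)] \<rho>0(2) K2 r by linarith+
  show thesis
  proof (rule that[OF \<rho>0(1)])
    fix b y U assume sol: "solution b y U" and close: "close_to_exact \<rho>0 y U"
    note tubes = tubes_around_close_solution[OF close \<rho>0(2) sol]
    have ys: "xL < y $ s" "y $ s < xR" and
      U: "smooth_solution D f a xL (y $ s) U" "smooth_solution D f a (y $ s) xR (right_part (y $ s) U)" and
      lax: "lax_shock D f lam (U (y $ s)) (right_part (y $ s) U (y $ s))" and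
      init: "U xL = UL (left_params s y)"
      using sol unfolding shock_solution_def by auto
    have "evolution D f a xL (y $ s) (U xL) = U (y $ s)"
      by (rule evolution_eq[OF U(1), where K = K and r = "r / 2"]) (use ys K r tubes in auto)
    moreover have "evolution D f a (y $ s) xR (right_part (y $ s) U (y $ s)) = right_part (y $ s) U xR"
      by (rule evolution_eq[OF U(2), where K = K and r = "r / 2"]) (use ys K r tubes in auto)
    moreover have "right_part (y $ s) U (y $ s) = Phi (U (y $ s))"
    proof (rule uniq[OF _ _ lax])
      have \<sigma>: "\<bar>y $ s - c\<bar> < \<rho>0" using close unfolding close_to_exact_def by blast
      note near = close_solution_near_shock[OF close small(1,2) sol \<sigma>]
      show "U (y $ s) \<in> N"
        using near(1) small(3) d1(2) ys by (auto simp: subset_iff dist_norm norm_minus_commute)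
      show "right_part (y $ s) U (y $ s) \<in> W"
        using near(2) small(4) d2(2) ys by (auto simp: subset_iff dist_norm norm_minus_commute)
    qed
    ultimately show "evolution D f a xL (y $ s) (UL (left_params s y)) = U (y $ s) \<and>
       Phi (U (y $ s)) = right_part (y $ s) U (y $ s) \<and>
       evolution D f a (y $ s) xR (right_part (y $ s) U (y $ s)) = U xR"
      using ys init by auto
  qed
qed

text \<open>Two mechanisms make the parameters visible in the mean. The difference of the left states,
  whose free components are the parameters, cannot decay faster than \<open>growth K\<close> allows on the
  first half of the left part. Between the two shock positions one solution is near the left and
  the other near the right exact state, so they differ there by at least half of the jump.\<close>

lemma parameters_bounded_by_L1_distance:
  obtains \<rho>0 C where "\<rho>0 > 0" "C \<ge> 0"
    "\<And>b y U b' z V. solution b y U \<Longrightarrow> close_to_exact \<rho>0 y U \<Longrightarrow>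
       solution b' z V \<Longrightarrow> close_to_exact \<rho>0 z V \<Longrightarrow>
       norm (y - z) \<le> C * integral {xL..xR} (\<lambda>x. norm (U x - V x))"
proof -
  have K2: "K\<^sup>2 \<ge> 1" using K by (simp add: one_le_power)
  define \<rho>0 where "\<rho>0 = Min {(c - xL) / 2, r / 2, r / (2 * K\<^sup>2), jump_size / (4 * (1 + K\<^sup>2)),
      r / (8 * growth K)}"
  have "0 < r / (2 * K\<^sup>2)" "0 < jump_size / (4 * (1 + K\<^sup>2))" "0 < r / (8 * growth K)"
    using r jump_size_pos K2 growth_K
    by (auto intro!: divide_pos_pos mult_pos_pos add_pos_pos simp del: zero_less_divide_iff)
  then have "\<rho>0 > 0" using r c_interior by (simp add: \<rho>0_def)
  moreover have "\<rho>0 \<le> (c - xL) / 2" "\<rho>0 \<le> r / 2" "\<rho>0 \<le> r / (2 * K\<^sup>2)"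
    "\<rho>0 \<le> jump_size / (4 * (1 + K\<^sup>2))" "\<rho>0 \<le> r / (8 * growth K)"
    unfolding \<rho>0_def by (rule Min_le, simp, simp)+
  ultimately have \<rho>0: "\<rho>0 > 0" "\<rho>0 \<le> (c - xL) / 2" "\<rho>0 \<le> r / 2" "\<rho>0 \<le> r / (2 * K\<^sup>2)"
    "\<rho>0 \<le> jump_size / (4 * (1 + K\<^sup>2))" "\<rho>0 \<le> r / (8 * growth K)" .
  have pos: "0 < 2 * K\<^sup>2" "0 < 4 * (1 + K\<^sup>2)" "0 < 8 * growth K"
    using K2 growth_K by auto
  have small: "K\<^sup>2 * \<rho>0 < r" "\<rho>0 < r" "(1 + K\<^sup>2) * \<rho>0 \<le> jump_size / 4"
      "growth K * (2 * \<rho>0) < r / 2"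
    using mult_le_of_le_divide[OF pos(1) \<rho>0(4)] mult_le_of_le_divide[OF pos(2) \<rho>0(5)] mult_le_of_le_divide[OF pos(3) \<rho>0(6)] \<rho>0(3) r
    by (linarith, linarith, simp_all add: algebra_simps)
  define C1 where "C1 = 2 * growth K / (c - xL)"
  define C2 where "C2 = 2 / jump_size"
  have C0: "C1 \<ge> 0" "C2 \<ge> 0"
    using growth_K c_interior jump_size_pos by (auto simp: C1_def C2_def)
  have left: "norm (U xL - V xL) \<le> C1 * integral {xL..xR} (\<lambda>x. norm (U x - V x))"
    if sol: "solution b y U" "solution b' z V" and close: "close_to_exact \<rho>0 y U" "close_to_exact \<rho>0 z V"
    for b y U b' z V
  proof -
    define m where "m = (xL + c) / 2"
    have m: "xL < m" "m < c" "m \<le> y $ s" "m \<le> z $ s" "m \<le> xR"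
      using close \<rho>0(2) c_interior by (auto simp: m_def close_to_exact_def field_simps)
    have U: "smooth_solution D f a xL m U" and V: "smooth_solution D f a xL m V"
      using sol m unfolding shock_solution_def by (auto intro: smooth_solution_subinterval)
    have "norm (U xL - V xL) / growth K \<le> norm (U x - V x)" if x: "x \<in> {xL<..m}" for x
    proof -
      have "x \<in> {xL..y $ s}" "x \<in> {xL..z $ s}" using x m by auto
      then have "norm (V x - Uex (min x c)) < \<rho>0" "norm (U x - Uex (min x c)) < \<rho>0"
        using close unfolding close_to_exact_def by blast+
      then have "norm (V x - U x) < 2 * \<rho>0"
        using norm_triangle_ineq4[of "V x - Uex (min x c)" "U x - Uex (min x c)"] by simp
      then have "growth K * norm (V x - U x) < r / 2"
        using small(4) growth_K by (smt (verit) mult_left_mono)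
      then have "norm (V xL - U xL) \<le> growth K * norm (V x - U x)"
        using x m K tubes_around_close_solution(1)[OF close(1) \<rho>0(3) sol(1)]
        by (intro smooth_solutions_stay_close[OF U V, where r = "r / 2"]) auto
      then show ?thesis
        using growth_K by (simp add: divide_le_eq norm_minus_commute mult.commute)
    qed
    then have "norm (U xL - V xL) / growth K * (m - xL) \<le> integral {xL..xR} (\<lambda>x. norm (U x - V x))"
      using m by (intro integral_ge_on_subinterval shock_solutions_distance_integrable[OF sol]) auto
    then have "C1 * (norm (U xL - V xL) / growth K * (m - xL))
        \<le> C1 * integral {xL..xR} (\<lambda>x. norm (U x - V x))"
      using C0(1) by (rule mult_left_mono)
    moreover have "C1 * (norm (U xL - V xL) / growth K * (m - xL)) = norm (U xL - V xL)"
      using growth_K c_interior by (simp add: C1_def m_def field_simps)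
    ultimately show ?thesis by simp
  qed
  have shock: "z $ s - y $ s \<le> C2 * integral {xL..xR} (\<lambda>x. norm (U x - V x))"
    if sol: "solution b y U" "solution b' z V" and close: "close_to_exact \<rho>0 y U" "close_to_exact \<rho>0 z V"
      and le: "y $ s \<le> z $ s"
    for b y U b' z V
  proof -
    have ys: "xL < y $ s" "z $ s < xR" using sol unfolding shock_solution_def by auto
    have "jump_size / 2 \<le> norm (U x - V x)" if x: "x \<in> {y $ s<..z $ s}" for x
    proof -
      have xc: "\<bar>x - c\<bar> < \<rho>0" using x close unfolding close_to_exact_def by auto
      have "norm (U x - Rex c) < jump_size / 4"
        using close_solution_near_shock(2)[OF close(1) small(1,2) sol(1) xc] x ys small(3) by auto
      moreover have "norm (V x - Uex c) < jump_size / 4"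
        using close_solution_near_shock(1)[OF close(2) small(1,2) sol(2) xc] x ys small(3) by auto
      ultimately have "norm ((V x - Uex c) - (U x - Rex c)) < jump_size / 2"
        using norm_triangle_ineq4[of "V x - Uex c" "U x - Rex c"] by linarith
      then have "norm ((Rex c - Uex c) - (U x - V x)) < jump_size / 2"
        by (simp add: algebra_simps)
      then show ?thesis
        using norm_triangle_ineq2[of "Rex c - Uex c" "U x - V x"] by (simp add: jump_size_def)
    qed
    then have "jump_size / 2 * (z $ s - y $ s) \<le> integral {xL..xR} (\<lambda>x. norm (U x - V x))"
      using ys le by (intro integral_ge_on_subinterval shock_solutions_distance_integrable[OF sol]) auto
    then show ?thesis using jump_size_pos by (simp add: C2_def field_simps)
  qed
  show thesis
  proof (rule that[OF \<rho>0(1), of "real CARD('m) * max C1 C2"])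
    show "real CARD('m) * max C1 C2 \<ge> 0" using C0 by simp
    fix b y U b' z V
    assume sol: "solution b y U" "solution b' z V"
      and close: "close_to_exact \<rho>0 y U" "close_to_exact \<rho>0 z V"
    let ?I = "integral {xL..xR} (\<lambda>x. norm (U x - V x))"
    have I0: "?I \<ge> 0" by (rule integral_nonneg[OF shock_solutions_distance_integrable[OF sol]]) simp
    have le: "C1 * ?I \<le> max C1 C2 * ?I" "C2 * ?I \<le> max C1 C2 * ?I"
      using I0 by (auto intro!: mult_right_mono)
    have "\<bar>(y - z) $ i\<bar> \<le> max C1 C2 * ?I" for i
    proof (cases "i = s")
      case True
      have "(\<lambda>x. norm (V x - U x)) = (\<lambda>x. norm (U x - V x))"
        by (simp add: norm_minus_commute)
      then have "\<bar>y $ s - z $ s\<bar> \<le> C2 * ?I"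
        using shock[OF sol close] shock[OF sol(2,1) close(2,1)] by (cases "y $ s \<le> z $ s") auto
      then show ?thesis using True le by simp
    next
      case False
      have "left_params s y \<in> param_space s" "left_params s z \<in> param_space s"
        by (simp_all add: left_params_def param_space_def)
      then have "U xL $ e i = y $ i" "V xL $ e i = z $ i"
        using sol False unfolding shock_solution_def
        by (simp_all add: free_components left_params_def)
      then have "\<bar>(y - z) $ i\<bar> = \<bar>(U xL - V xL) $ e i\<bar>" by simp
      also have "\<dots> \<le> norm (U xL - V xL)" by (rule component_le_norm_cart)
      also have "\<dots> \<le> C1 * ?I" by (rule left[OF sol close])
      finally show ?thesis using le by simp
    qed
    then have "(\<Sum>i\<in>UNIV. \<bar>(y - z) $ i\<bar>) \<le> real CARD('m) * (max C1 C2 * ?I)"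
      by (intro sum_bounded_above) 
    then show "norm (y - z) \<le> real CARD('m) * max C1 C2 * ?I"
      using norm_le_l1_cart[of "y - z"] by simp
  qed
qed

text \<open>A small \<open>L1\<close> distance provides, in every interval of length \<open>\<delta>\<close>, a point at which the
  solutions are within \<open>\<theta>\<close>. If the shock were not within \<open>\<delta>\<close> of the exact one, a smooth branch would
  cover \<open>[c - \<delta>, c + \<delta>]\<close> and be close to \<open>Uex\<close> at points on both sides of \<open>c\<close>; its value at \<open>c\<close> would
  then be close to both exact one-sided states, which differ. With the shock located, each branch
  is compared with the exact one from a single good point near an end of the interval.\<close>

lemma close_if_L1_close:
  assumes \<rho>: "\<rho> > 0"
  obtains \<eta> where "\<eta> > 0"
    "\<And>b y U. solution b y U \<Longrightarrow> integral {xL..xR} (\<lambda>x. norm (U x - Uex x)) < \<eta> \<Longrightarrow>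
       close_to_exact \<rho> y U"
proof -
  have K2: "K\<^sup>2 \<ge> 1" using K by (simp add: one_le_power)
  define \<delta> where "\<delta> = Min {(c - xL) / 3, (xR - c) / 3, r / (4 * K\<^sup>2), \<rho> / (4 * K\<^sup>2)}"
  have "0 < r / (4 * K\<^sup>2)" "0 < \<rho> / (4 * K\<^sup>2)"
    by (rule divide_pos_pos; use r \<rho> K2 in linarith)+
  then have "\<delta> > 0" using c_interior by (simp add: \<delta>_def)
  moreover have "\<delta> \<le> (c - xL) / 3" "\<delta> \<le> (xR - c) / 3" "\<delta> \<le> r / (4 * K\<^sup>2)" "\<delta> \<le> \<rho> / (4 * K\<^sup>2)"
    unfolding \<delta>_def by (rule Min_le, simp, simp)+
  ultimately have \<delta>: "\<delta> > 0" "\<delta> \<le> (c - xL) / 3" "\<delta> \<le> (xR - c) / 3" "\<delta> \<le> r / (4 * K\<^sup>2)" "\<delta> \<le> \<rho> / (4 * K\<^sup>2)" .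
  have K\<delta>: "K\<^sup>2 * \<delta> \<le> r / 4" "K\<^sup>2 * \<delta> \<le> \<rho> / 4"
    using mult_le_of_le_divide[OF _ \<delta>(4)] mult_le_of_le_divide[OF _ \<delta>(5)] K2 by linarith+
  have "1 * \<delta> \<le> K\<^sup>2 * \<delta>" using K2 \<delta>(1) by (intro mult_right_mono) auto
  then have \<delta>': "\<delta> < r" "\<delta> < \<rho>" using K\<delta> r \<rho> by auto
  define \<theta> where "\<theta> = Min {r / 4, \<rho> / 4, jump_size / 4} / growth K"
  have \<theta>: "\<theta> > 0" using r \<rho> jump_size_pos growth_K by (auto simp: \<theta>_def)
  have "growth K * \<theta> = Min {r / 4, \<rho> / 4, jump_size / 4}" using growth_K by (simp add: \<theta>_def)
  then have G\<theta>: "growth K * \<theta> \<le> r / 4" "growth K * \<theta> \<le> \<rho> / 4" "growth K * \<theta> \<le> jump_size / 4"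
    by auto
  have G\<theta>': "growth K * t \<le> growth K * \<theta>" if "t \<le> \<theta>" for t
    using that growth_K by (intro mult_left_mono) auto
  show thesis
  proof (rule that[of "\<theta> * \<delta>"])
    show "\<theta> * \<delta> > 0" using \<theta> \<delta> by simp
    fix b y U assume sol: "solution b y U"
      and L1: "integral {xL..xR} (\<lambda>x. norm (U x - Uex x)) < \<theta> * \<delta>"
    let ?\<sigma> = "y $ s" and ?R = "right_part (y $ s) U"
    have \<sigma>: "xL < ?\<sigma>" "?\<sigma> < xR" and U: "smooth_solution D f a xL ?\<sigma> U"
      and R: "smooth_solution D f a ?\<sigma> xR ?R"
      using sol unfolding shock_solution_def by auto
    have pick: "\<exists>x\<in>{u<..v}. norm (U x - Uex x) \<le> \<theta>" if "xL \<le> u" "v \<le> xR" "v - u = \<delta>" for u v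
    proof (rule ccontr)
      assume "\<not> ?thesis"
      then have "\<theta> * (v - u) \<le> integral {xL..xR} (\<lambda>x. norm (U x - Uex x))"
        using that \<delta>(1)
        by (intro integral_ge_on_subinterval shock_solutions_distance_integrable[OF sol exact]) (auto simp: not_le intro: less_imp_le)
      then show False using L1 that by simp
    qed
    have no_smooth_crossing: False
      if W: "smooth_solution D f a (c - \<delta>) (c + \<delta>) W" and eq: "\<And>x. x \<in> {c - \<delta><..c + \<delta>} \<Longrightarrow> W x = U x"
      for W
    proof -
      obtain x1 where x1: "x1 \<in> {c - \<delta><..c}" "norm (U x1 - Uex x1) \<le> \<theta>"
        using pick[of "c - \<delta>" c] \<delta> c_interior by auto
      obtain x2 where x2: "x2 \<in> {c<..c + \<delta>}" "norm (U x2 - Uex x2) \<le> \<theta>"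
        using pick[of c "c + \<delta>"] \<delta> c_interior by auto
      have n1: "norm (W x1 - Uex x1) \<le> \<theta>" and n2: "norm (W x2 - Rex x2) \<le> \<theta>"
        using x1 x2 eq \<delta>(1) by auto
      have "norm (W c - Uex c) \<le> growth K * norm (W x1 - Uex x1)"
      proof (rule smooth_solutions_stay_close[of "c - \<delta>" c])
        show "smooth_solution D f a (c - \<delta>) c Uex"
          using exact_left by (rule smooth_solution_subinterval) (use \<delta> c_interior in auto)
        show "smooth_solution D f a (c - \<delta>) c W"
          using W by (rule smooth_solution_subinterval) (use \<delta> in auto)
        show "growth K * norm (W x1 - Uex x1) < r" using G\<theta>'[OF n1] G\<theta>(1) r by linarith
      qed (use x1 \<delta> c_interior K left_tube in auto)
      moreover have "norm (W c - Rex c) \<le> growth K * norm (W x2 - Rex x2)"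
      proof (rule smooth_solutions_stay_close[of c "c + \<delta>"])
        show "smooth_solution D f a c (c + \<delta>) Rex"
          using exact_right by (rule smooth_solution_subinterval) (use \<delta> c_interior in auto)
        show "smooth_solution D f a c (c + \<delta>) W"
          using W by (rule smooth_solution_subinterval) (use \<delta> in auto)
        show "growth K * norm (W x2 - Rex x2) < r" using G\<theta>'[OF n2] G\<theta>(1) r by linarith
      qed (use x2 \<delta> c_interior K right_tube in auto)
      ultimately have "norm (W c - Uex c) \<le> jump_size / 4" "norm (W c - Rex c) \<le> jump_size / 4"
        using G\<theta>'[OF n1] G\<theta>'[OF n2] G\<theta>(3) by linarith+
      moreover have "jump_size \<le> norm (W c - Uex c) + norm (W c - Rex c)"
        using norm_triangle_ineq4[of "W c - Uex c" "W c - Rex c"] by (simp add: jump_size_def)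
      ultimately show False using jump_size_pos by linarith
    qed
    have shock_close: "\<bar>?\<sigma> - c\<bar> < \<delta>"
    proof (rule ccontr)
      assume "\<not> ?thesis"
      then consider "?\<sigma> \<le> c - \<delta>" | "c + \<delta> \<le> ?\<sigma>" by linarith
      then show False
      proof cases
        case 1
        have "smooth_solution D f a (c - \<delta>) (c + \<delta>) ?R"
          using R by (rule smooth_solution_subinterval) (use 1 \<delta> c_interior in auto)
        then show False by (rule no_smooth_crossing) (use 1 in simp)
      next
        case 2
        have "smooth_solution D f a (c - \<delta>) (c + \<delta>) U"
          using U by (rule smooth_solution_subinterval) (use 2 \<delta> c_interior in auto)
        then show False by (rule no_smooth_crossing) simp
      qed
    qed
    have total: "growth K * \<theta> + K\<^sup>2 * \<delta> < r" "growth K * \<theta> + K\<^sup>2 * \<delta> < \<rho>"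
      using G\<theta> K\<delta> r \<rho> by linarith+
    have left: "norm (U x - Uex (min x c)) < \<rho>" if x: "x \<in> {xL..?\<sigma>}" for x
    proof -
      obtain x1 where x1: "x1 \<in> {xL<..xL + \<delta>}" "norm (U x1 - Uex x1) \<le> \<theta>"
        using pick[of xL "xL + \<delta>"] \<delta> c_interior by auto
      have "norm (U x - Uex (max xL (min x c))) \<le> growth K * \<theta> + K\<^sup>2 * \<delta>"
        by (rule clamped_comparison[OF exact_left U _ _ _ _ _ K left_tube _ _ _ x1(2) total(1) \<delta>'(1) x])
          (use x1(1) \<delta> shock_close \<sigma> c_interior in \<open>auto simp: max_def min_def\<close>)
      moreover have "max xL (min x c) = min x c" using x c_interior by auto
      ultimately show ?thesis using total(2) by simp
    qed
    have right: "norm (?R x - Rex (max x c)) < \<rho>" if x: "x \<in> {?\<sigma>..xR}" for x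
    proof -
      obtain x1 where x1: "x1 \<in> {xR - \<delta><..xR}" "norm (U x1 - Uex x1) \<le> \<theta>"
        using pick[of "xR - \<delta>" xR] \<delta> c_interior by auto
      have "?\<sigma> < x1" "c < x1" using x1 \<delta> shock_close by auto
      then have n1: "norm (?R x1 - Rex x1) \<le> \<theta>" using x1(2) by simp
      have "norm (?R x - Rex (max c (min x xR))) \<le> growth K * \<theta> + K\<^sup>2 * \<delta>"
        by (rule clamped_comparison[OF exact_right R _ _ _ _ _ K right_tube _ _ _ n1 total(1) \<delta>'(1) x])
          (use x1(1) \<delta> shock_close \<sigma> c_interior in \<open>auto simp: max_def min_def\<close>)
      moreover have "max c (min x xR) = max x c" using x by auto
      ultimately show ?thesis using total(2) by simp
    qed
    show "close_to_exact \<rho> y U"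
      unfolding close_to_exact_def using shock_close \<delta>'(2) left right by auto
  qed
qed

end

lemma accurate_near_pairE:
  assumes "accurate_near k (\<lambda>h (x, u). F h x u) (\<lambda>(x, u). G x u) z0"
  obtains C r h0 where "r > 0" "h0 > 0"
    "\<And>h x u. h \<in> {0<..h0} \<Longrightarrow> (x, u) \<in> ball z0 r \<Longrightarrow> norm (F h x u - G x u) \<le> C * h powr k"
proof -
  obtain C r h0 where pos: "r > 0" "h0 > 0" and bound: "\<And>h z. h \<in> {0<..h0} \<Longrightarrow> z \<in> ball z0 r \<Longrightarrow>
      norm ((case z of (x, u) \<Rightarrow> F h x u) - (case z of (x, u) \<Rightarrow> G x u)) \<le> C * h powr k"
    using assms unfolding accurate_near_def by blast
  have "norm (F h x u - G x u) \<le> C * h powr k"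
    if "h \<in> {0<..h0}" "(x, u) \<in> ball z0 r" for h x u
    using bound[OF that] by simp
  with pos show thesis by (rule that)
qed

context exact_shock
begin

section \<open>The exact residual as a local coordinate\<close>

text \<open>The parameters \<open>Y b\<close> of the solution for the right data \<open>b\<close> are Lipschitz in \<open>b\<close>, since stability
  bounds the \<open>L1\<close> distance and that distance bounds the parameters. The exact residual is a left inverse
  of \<open>Y\<close>, so \<open>Y\<close> is injective and, the dimensions being equal, open by invariance of domain.\<close>

lemma parameters_near_exact_are_attained:
  assumes stab: "L1_stable D f lam a xL xR s UL BR" and dim: "CARD('m) = CARD('j)"
    and \<rho>: "\<rho> > 0"
  obtains Y C where "open Y" "yex \<in> Y" "C \<ge> 0"
    "\<And>y. y \<in> Y \<Longrightarrow> \<exists>b U. solution b y U \<and> close_to_exact \<rho> y U \<and> norm (y - yex) \<le> C * norm b"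
proof -
  obtain \<epsilon> C1 where \<epsilon>: "\<epsilon> > 0"
    and ex: "\<And>b. b \<in> ball 0 \<epsilon> \<Longrightarrow> \<exists>y U. unique_shock_solution D f lam a xL xR s UL BR b y U"
    and L1: "\<And>b b' y z U V. b \<in> ball 0 \<epsilon> \<Longrightarrow> b' \<in> ball 0 \<epsilon> \<Longrightarrow> solution b y U \<Longrightarrow> solution b' z V \<Longrightarrow>
       integral {xL..xR} (\<lambda>x. norm (U x - V x)) \<le> C1 * norm (b - b')"
    using stab unfolding L1_stable_def by blast
  obtain \<rho>1 where \<rho>1: "\<rho>1 > 0"
    and op: "\<And>b y U. solution b y U \<Longrightarrow> close_to_exact \<rho>1 y U \<Longrightarrow>
       evolution D f a xL (y $ s) (UL (left_params s y)) = U (y $ s) \<and>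
       Phi (U (y $ s)) = right_part (y $ s) U (y $ s) \<and>
       evolution D f a (y $ s) xR (right_part (y $ s) U (y $ s)) = U xR"
    using exact_operators_on_close_solutions by metis
  obtain \<rho>2 C2 where \<rho>2: "\<rho>2 > 0" "C2 \<ge> 0"
    and par: "\<And>b y U b' z V. solution b y U \<Longrightarrow> close_to_exact \<rho>2 y U \<Longrightarrow>
       solution b' z V \<Longrightarrow> close_to_exact \<rho>2 z V \<Longrightarrow>
       norm (y - z) \<le> C2 * integral {xL..xR} (\<lambda>x. norm (U x - V x))"
    by (rule parameters_bounded_by_L1_distance) (rule that)
  define \<rho>0 where "\<rho>0 = min \<rho> (min \<rho>1 \<rho>2)"
  have \<rho>0: "\<rho>0 > 0" "\<rho>0 \<le> \<rho>" "\<rho>0 \<le> \<rho>1" "\<rho>0 \<le> \<rho>2" using \<rho> \<rho>1 \<rho>2 by (auto simp: \<rho>0_def)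
  obtain \<eta> where \<eta>: "\<eta> > 0"
    and near: "\<And>b y U. solution b y U \<Longrightarrow> integral {xL..xR} (\<lambda>x. norm (U x - Uex x)) < \<eta> \<Longrightarrow>
       close_to_exact \<rho>0 y U"
    using close_if_L1_close[OF \<rho>0(1)] by metis
  \<comment> \<open>Data so small that \<open>L1\<close> stability brings every solution within \<open>\<eta>\<close> of the exact one.\<close>
  define B where "B = ball (0::real^'j) (min \<epsilon> (\<eta> / (\<bar>C1\<bar> + 1)))"
  have B0: "0 \<in> B" using \<epsilon> \<eta> by (simp add: B_def)
  have B\<epsilon>: "b \<in> ball 0 \<epsilon>" if "b \<in> B" for b using that by (simp add: B_def)
  obtain Y U where sol: "\<And>b. b \<in> B \<Longrightarrow> solution b (Y b) (U b)"
    using ex B\<epsilon> unfolding unique_shock_solution_def by metis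
  have close: "close_to_exact \<rho>0 (Y b) (U b)" if b: "b \<in> B" for b
  proof (rule near[OF sol[OF b]])
    have "integral {xL..xR} (\<lambda>x. norm (U b x - Uex x)) \<le> C1 * norm (b - 0)"
      using \<epsilon> by (intro L1[OF B\<epsilon>[OF b] _ sol[OF b] exact]) simp
    also have "\<dots> \<le> (\<bar>C1\<bar> + 1) * norm b" by (simp add: mult_right_mono)
    also have "\<dots> < (\<bar>C1\<bar> + 1) * (\<eta> / (\<bar>C1\<bar> + 1))"
      using b by (intro mult_strict_left_mono) (auto simp: B_def)
    also have "\<dots> = \<eta>" by simp
    finally show "integral {xL..xR} (\<lambda>x. norm (U b x - Uex x)) < \<eta>" .
  qed
  define C where "C = C2 * \<bar>C1\<bar>"
  have bound: "norm (y - z) \<le> C * norm (b - b')"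
    if b: "b \<in> B" "b' \<in> B" and y: "solution b y V" "close_to_exact \<rho>0 y V"
      and z: "solution b' z W" "close_to_exact \<rho>0 z W" for b b' y z V W
  proof -
    have "norm (y - z) \<le> C2 * integral {xL..xR} (\<lambda>x. norm (V x - W x))"
      using par y z close_to_exact_mono \<rho>0(4) by blast
    also have "\<dots> \<le> C2 * (C1 * norm (b - b'))"
      using L1[OF B\<epsilon>[OF b(1)] B\<epsilon>[OF b(2)] y(1) z(1)] \<rho>2(2) by (rule mult_left_mono)
    also have "\<dots> \<le> C2 * (\<bar>C1\<bar> * norm (b - b'))"
      using \<rho>2(2) by (intro mult_left_mono mult_right_mono) auto
    finally show ?thesis by (simp add: C_def mult.assoc)
  qed
  have C0: "C \<ge> 0" using \<rho>2(2) by (simp add: C_def)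
  have Y_lipschitz: "norm (Y b - Y b') \<le> C * norm (b - b')" if "b \<in> B" "b' \<in> B" for b b'
    using bound[OF that sol[OF that(1)] close[OF that(1)] sol[OF that(2)] close[OF that(2)]] .
  have "C-lipschitz_on B Y"
    using Y_lipschitz C0 by (intro lipschitz_onI) (auto simp: dist_norm)
  then have "continuous_on B Y" by (rule lipschitz_on_continuous_on)
  moreover have "inj_on Y B"
  proof (rule inj_on_inverseI)
    fix b assume b: "b \<in> B"
    have "BR (U b xR) = b" using sol[OF b] unfolding shock_solution_def by blast
    then show "residual xL xR s UL BR (evolution D f a) Phi (Y b) = b"
      using op[OF sol[OF b] close_to_exact_mono[OF close[OF b] \<rho>0(3)]]
      by (simp add: residual_def right_end_state_def pre_shock_state_def)
  qed
  ultimately have "open (Y ` B)"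
    using dim by (intro invariance_of_domain_gen) (auto simp: B_def)
  moreover have Y0: "Y 0 = yex"
    using bound[OF B0 B0 sol[OF B0] close[OF B0] exact close_to_exact_self[OF \<rho>0(1)]] by simp
  then have "yex \<in> Y ` B" using B0 by (metis imageI)
  moreover have "\<exists>b U. solution b y U \<and> close_to_exact \<rho> y U \<and> norm (y - yex) \<le> C * norm b"
    if "y \<in> Y ` B" for y
  proof -
    obtain b where b: "b \<in> B" "y = Y b" using \<open>y \<in> Y ` B\<close> by blast
    have "norm (y - yex) \<le> C * norm b"
      using Y_lipschitz[OF b(1) B0] b(2) Y0 by simp
    then show ?thesis
      using sol[OF b(1)] close_to_exact_mono[OF close[OF b(1)] \<rho>0(2)] b(2) by blast
  qed
  ultimately show thesis using that C0 by blast
qed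

section \<open>The discrete residual\<close>

text \<open>The errors of the three stages are followed along the shock solution with parameters \<open>y\<close>: each
  stage adds its own error of order \<open>k\<close> and amplifies the error already present by a Lipschitz
  constant. For the jump this is the constant of the exact operator; for the last evolution it is the stability constant of the discrete operator, so that the
  exact evolution is only ever applied to states of an existing solution.\<close>

lemma discrete_residual_error:
  assumes order: "k > 0"
    and hyperbolic: "strictly_hyperbolic D f lam"
    and reg: "C11_diffeo_near f (Uex c)" "C11_diffeo_near f (Rex c)"
    and BR: "lipschitz_near UNIV BR (Uex xR)"
    and stable: "stable_near (\<lambda>h x U. Ph h x xR U) c (Phi (Uex c))"
    and accurate:
      "accurate_near k (\<lambda>h (x, U). Ph h xL x U) (\<lambda>(x, U). evolution D f a xL x U) (c, Uex xL)"
      "accurate_near k Phih Phi (Uex c)"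
      "accurate_near k (\<lambda>h (x, U). Ph h x xR U) (\<lambda>(x, U). evolution D f a x xR U) (c, Phi (Uex c))"
  obtains \<rho> h0 C where "\<rho> > 0" "h0 > 0" "C \<ge> 0"
    "\<And>h b y U. h \<in> {0<..h0} \<Longrightarrow> solution b y U \<Longrightarrow> close_to_exact \<rho> y U \<Longrightarrow>
       norm (residual xL xR s UL BR (Ph h) (Phih h) y - b) \<le> C * h powr k"
proof -
  obtain C1 r1 h1 where 1: "r1 > 0" "h1 > 0" "\<And>h x u. h \<in> {0<..h1} \<Longrightarrow> (x, u) \<in> ball (c, Uex xL) r1 \<Longrightarrow>
      norm (Ph h xL x u - evolution D f a xL x u) \<le> C1 * h powr k"
    using accurate(1) by (rule accurate_near_pairE) (rule that)
  obtain C2 r2 h2 where 2: "r2 > 0" "h2 > 0" "\<And>h u. h \<in> {0<..h2} \<Longrightarrow> u \<in> ball (Uex c) r2 \<Longrightarrow>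
      norm (Phih h u - Phi u) \<le> C2 * h powr k"
    using accurate(2) unfolding accurate_near_def by blast
  obtain C3 r3 h3 where 3: "r3 > 0" "h3 > 0" "\<And>h x u. h \<in> {0<..h3} \<Longrightarrow> (x, u) \<in> ball (c, Rex c) r3 \<Longrightarrow>
      norm (Ph h x xR u - evolution D f a x xR u) \<le> C3 * h powr k"
    using accurate(3) unfolding jump_exact by (rule accurate_near_pairE) (rule that)
  obtain L4 r4 h4 where 4: "r4 > 0" "h4 > 0" "\<And>h x. h \<in> {0<..h4} \<Longrightarrow> x \<in> ball c r4 \<Longrightarrow>
      L4-lipschitz_on (ball (Rex c) r4) (Ph h x xR)"
    using stable unfolding stable_near_def jump_exact by blast
  obtain r5 L5 where 5: "r5 > 0" "L5 \<ge> 0" "\<And>u v. u \<in> ball (Uex c) r5 \<Longrightarrow> v \<in> ball (Uex c) r5 \<Longrightarrow>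
      norm (Phi u - Phi v) \<le> L5 * norm (u - v)"
    using jump_operator_lipschitz[OF open_D hyperbolic jump_operator reg(1)] reg(2) jump_exact by metis
  obtain r6 L6 where 6: "r6 > 0" "L6-lipschitz_on (ball (Uex xR) r6) BR"
    using BR unfolding lipschitz_near_def by auto
  obtain \<rho>1 where 7: "\<rho>1 > 0" "\<And>b y U. solution b y U \<Longrightarrow> close_to_exact \<rho>1 y U \<Longrightarrow>
       evolution D f a xL (y $ s) (UL (left_params s y)) = U (y $ s) \<and>
       Phi (U (y $ s)) = right_part (y $ s) U (y $ s) \<and>
       evolution D f a (y $ s) xR (right_part (y $ s) U (y $ s)) = U xR"
    using exact_operators_on_close_solutions by metis
  have L4: "L4 \<ge> 0" using lipschitz_on_nonneg[OF 4(3)[of h4 c]] 4 by simp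
  have L6: "L6 \<ge> 0" using 6(2) by (rule lipschitz_on_nonneg)
  define d where "d = Min {r1, r2, r3, r4, r5, r6, r}"
  have "d > 0" using 1(1) 2(1) 3(1) 4(1) 5(1) 6(1) r by (simp add: d_def)
  moreover have "d \<le> r1" "d \<le> r2" "d \<le> r3" "d \<le> r4" "d \<le> r5" "d \<le> r6" "d \<le> r"
    unfolding d_def by (rule Min_le, simp, simp)+
  ultimately have d: "d > 0" "d \<le> r1" "d \<le> r2" "d \<le> r3" "d \<le> r4" "d \<le> r5" "d \<le> r6" "d \<le> r" .
  \<comment> \<open>Constants of the accumulated errors before the shock, behind it, and at the right end.\<close>
  define E1 where "E1 = \<bar>C1\<bar>"
  define E2 where "E2 = \<bar>C2\<bar> + L5 * E1"
  define E3 where "E3 = \<bar>C3\<bar> + L4 * E2"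
  have E0: "E1 \<ge> 0" "E2 \<ge> 0" "E3 \<ge> 0" using 5(2) L4 by (auto simp: E1_def E2_def E3_def)
  define Q where "Q = 2 * (1 + K\<^sup>2)"
  have Q: "Q \<ge> 2" by (simp add: Q_def)
  define \<rho> where "\<rho> = min \<rho>1 (d / (2 * Q))"
  have "\<rho> \<le> d / (2 * Q)" "\<rho> > 0" using 7(1) d(1) Q by (auto simp: \<rho>_def)
  then have Q\<rho>: "Q * \<rho> \<le> d / 2" using Q by (simp add: field_simps)
  have "2 * \<rho> \<le> Q * \<rho>" using Q \<open>\<rho> > 0\<close> by (intro mult_right_mono) auto
  moreover have "Q * \<rho> = 2 * ((1 + K\<^sup>2) * \<rho>)" by (simp add: Q_def)
  moreover have "K\<^sup>2 * \<rho> \<le> (1 + K\<^sup>2) * \<rho>" using \<open>\<rho> > 0\<close> by (intro mult_right_mono) auto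
  moreover have "\<rho> \<le> \<rho>1" by (simp add: \<rho>_def)
  ultimately have \<rho>: "\<rho> > 0" "\<rho> \<le> \<rho>1" "(1 + K\<^sup>2) * \<rho> \<le> d / 4" "2 * \<rho> \<le> d / 2" "K\<^sup>2 * \<rho> < r" "\<rho> < r"
    using \<open>\<rho> > 0\<close> Q\<rho> d(1,8) by linarith+
  define M where "M = E1 + E2 + E3 + 1"
  have M: "M \<ge> 1" "E1 \<le> M" "E2 \<le> M" "E3 \<le> M" using E0 by (auto simp: M_def)
  \<comment> \<open>The last entry makes each accumulated error at most \<open>d / 2\<close>, so that the discrete states do not
    leave the balls of radius \<open>d\<close>.\<close>
  define h0 where "h0 = Min {h1, h2, h3, h4, (d / (2 * M)) powr (1 / k)}"
  have h0: "h0 > 0" "h0 \<le> h1" "h0 \<le> h2" "h0 \<le> h3" "h0 \<le> h4" "h0 \<le> (d / (2 * M)) powr (1 / k)"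
    using 1(2) 2(2) 3(2) 4(2) d(1) M(1) by (auto simp: h0_def)
  show thesis
  proof (rule that[OF \<rho>(1) h0(1), of "L6 * E3"])
    show "L6 * E3 \<ge> 0" using L6 E0 by simp
    fix h b y U assume h: "h \<in> {0<..h0}" and sol: "solution b y U" and close: "close_to_exact \<rho> y U"
    let ?\<sigma> = "y $ s" and ?H = "h powr k"
    let ?R = "right_part ?\<sigma> U"
    have hs: "h \<in> {0<..h1}" "h \<in> {0<..h2}" "h \<in> {0<..h3}" "h \<in> {0<..h4}" using h h0 by auto
    have "?H \<le> ((d / (2 * M)) powr (1 / k)) powr k"
      using h h0(6) order by (intro powr_mono2) auto
    also have "\<dots> = d / (2 * M)" using order d(1) M(1) by (simp add: powr_powr)
    finally have "M * ?H \<le> M * (d / (2 * M))" using M(1) by (intro mult_left_mono) auto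
    also have "\<dots> = d / 2" using M(1) by simp
    finally have MH: "M * ?H \<le> d / 2" .
    have EH: "E1 * ?H \<le> d / 2" "E2 * ?H \<le> d / 2" "E3 * ?H \<le> d / 2"
      using MH M mult_right_mono[of _ M ?H] by (meson order_trans powr_ge_zero)+
    have absH: "C' * ?H \<le> \<bar>C'\<bar> * ?H" for C' by (simp add: mult_right_mono)
    have \<sigma>: "xL < ?\<sigma>" "?\<sigma> < xR" and init: "U xL = UL (left_params s y)" and final: "BR (U xR) = b"
      using sol unfolding shock_solution_def by auto
    have \<sigma>c: "\<bar>?\<sigma> - c\<bar> < \<rho>" using close unfolding close_to_exact_def by blast
    have ends: "norm (U xL - Uex xL) < \<rho>" "norm (U xR - Uex xR) < \<rho>"
    proof -
      have "norm (U xL - Uex (min xL c)) < \<rho>" "norm (?R xR - Rex (max xR c)) < \<rho>"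
        using close \<sigma> unfolding close_to_exact_def by (simp_all del: right_part_off_shock)
      then show "norm (U xL - Uex xL) < \<rho>" "norm (U xR - Uex xR) < \<rho>"
        using c_interior \<sigma> by auto
    qed
    have atshock: "norm (U ?\<sigma> - Uex c) < d / 4" "norm (?R ?\<sigma> - Rex c) < d / 4"
      using close_solution_near_shock[OF close \<rho>(5,6) sol \<sigma>c] \<sigma> \<rho>(3) by auto
    note ops = 7(2)[OF sol close_to_exact_mono[OF close \<rho>(2)]]
    have pair: "(x, u) \<in> ball (c, w) d" if "\<bar>x - c\<bar> < \<rho>" "norm (u - w) < d / 2" for x and u w :: "real^'n"
    proof -
      have "dist (c, w) (x, u) \<le> dist c x + dist w u"
        using sqrt_sum_squares_le_sum[of "dist c x" "dist w u"] by (simp add: dist_Pair_Pair)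
      also have "\<dots> < \<rho> + d / 2"
        using that by (simp add: dist_norm norm_minus_commute)
      finally show ?thesis using \<rho>(4) d(1) by simp
    qed
    define p where "p = Ph h xL ?\<sigma> (U xL)"
    have p: "norm (p - U ?\<sigma>) \<le> E1 * ?H"
    proof -
      have "(?\<sigma>, U xL) \<in> ball (c, Uex xL) r1"
        using pair[OF \<sigma>c, of "U xL" "Uex xL"] ends(1) \<rho>(1,4) d(1,2) by auto
      then show ?thesis using 1(3)[OF hs(1)] ops absH[of C1] init by (fastforce simp: p_def E1_def)
    qed
    have p_ball: "p \<in> ball (Uex c) d" "U ?\<sigma> \<in> ball (Uex c) d"
      using norm_triangle_ineq[of "p - U ?\<sigma>" "U ?\<sigma> - Uex c"] p EH(1) atshock(1) d(1)
      by (auto simp: dist_norm norm_minus_commute)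
    define q where "q = Phih h p"
    have q: "norm (q - ?R ?\<sigma>) \<le> E2 * ?H"
    proof -
      have "norm (q - Phi p) \<le> \<bar>C2\<bar> * ?H"
        using 2(3)[OF hs(2), of p] p_ball(1) d(3) absH[of C2] by (auto simp: q_def)
      moreover have "norm (Phi p - Phi (U ?\<sigma>)) \<le> L5 * norm (p - U ?\<sigma>)"
        using p_ball d(6) by (intro 5(3)) auto
      moreover have "L5 * norm (p - U ?\<sigma>) \<le> L5 * (E1 * ?H)" using p 5(2) by (rule mult_left_mono)
      ultimately show ?thesis
        using norm_triangle_ineq[of "q - Phi p" "Phi p - Phi (U ?\<sigma>)"] ops
        by (simp add: E2_def algebra_simps)
    qed
    have q_ball: "q \<in> ball (Rex c) d" "?R ?\<sigma> \<in> ball (Rex c) d"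
      using norm_triangle_ineq[of "q - ?R ?\<sigma>" "?R ?\<sigma> - Rex c"] q EH(2) atshock(2) d(1)
      by (auto simp: dist_norm norm_minus_commute)
    define w where "w = Ph h ?\<sigma> xR q"
    have w: "norm (w - U xR) \<le> E3 * ?H"
    proof -
      have "?\<sigma> \<in> ball c r4" using \<sigma>c \<rho>(4) d(1,5) \<rho>(1) by (auto simp: dist_real_def)
      then have "norm (w - Ph h ?\<sigma> xR (?R ?\<sigma>)) \<le> L4 * norm (q - ?R ?\<sigma>)"
        using lipschitz_onD[OF 4(3)[OF hs(4)], of ?\<sigma> q "?R ?\<sigma>"] q_ball d(5)
        by (auto simp: dist_norm w_def)
      moreover have "L4 * norm (q - ?R ?\<sigma>) \<le> L4 * (E2 * ?H)" using q L4 by (rule mult_left_mono)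
      moreover have "norm (Ph h ?\<sigma> xR (?R ?\<sigma>) - U xR) \<le> \<bar>C3\<bar> * ?H"
      proof -
        have "(?\<sigma>, ?R ?\<sigma>) \<in> ball (c, Rex c) r3"
          using pair[OF \<sigma>c, of "?R ?\<sigma>" "Rex c"] atshock(2) d(1,4) by auto
        then show ?thesis using 3(3)[OF hs(3)] ops absH[of C3] by fastforce
      qed
      ultimately show ?thesis
        using norm_triangle_ineq[of "w - Ph h ?\<sigma> xR (?R ?\<sigma>)" "Ph h ?\<sigma> xR (?R ?\<sigma>) - U xR"]
        by (simp add: E3_def algebra_simps)
    qed
    have w_ball: "w \<in> ball (Uex xR) d" "U xR \<in> ball (Uex xR) d"
      using norm_triangle_ineq[of "w - U xR" "U xR - Uex xR"] w EH(3) ends(2) \<rho>(1,4) d(1)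
      by (auto simp: dist_norm norm_minus_commute)
    have "norm (BR w - BR (U xR)) \<le> L6 * norm (w - U xR)"
      using lipschitz_onD[OF 6(2), of w "U xR"] w_ball d(7) by (auto simp: dist_norm)
    also have "\<dots> \<le> L6 * (E3 * ?H)" using w L6 by (rule mult_left_mono)
    finally show "norm (residual xL xR s UL BR (Ph h) (Phih h) y - b) \<le> L6 * E3 * ?H"
      using init final
      by (simp add: residual_def right_end_state_def pre_shock_state_def w_def q_def p_def mult.assoc)
  qed
qed

end

theorem theorem2:
  fixes D :: "(real^'n::finite) set"
    and f :: "real^'n \<Rightarrow> real^'n"
    and lam :: "nat \<Rightarrow> real^'n \<Rightarrow> real"
    and a :: "real^'n \<Rightarrow> real \<Rightarrow> real^'n"
    and xL xR :: real
    and s :: "'m::finite"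
    and e :: "'m::finite \<Rightarrow> 'n::finite"
    and UL :: "real^'m \<Rightarrow> real^'n"
    and BR :: "real^'n \<Rightarrow> real^'j::finite"
    and Phi :: "real^'n \<Rightarrow> real^'n"
    and yex :: "real^'m"
    and Uex :: "real \<Rightarrow> real^'n"
    and I J :: nat
    and Ph :: "real \<Rightarrow> real \<Rightarrow> real \<Rightarrow> real^'n \<Rightarrow> real^'n"
    and Phih :: "real \<Rightarrow> real^'n \<Rightarrow> real^'n"
    and k :: real
  assumes interval: "xL < xR"
    and state_space: "open D"
    and hyperbolic: "strictly_hyperbolic D f lam"
    and dims: "CARD('m) = I + 1" "CARD('j) = J" "J = I + 1" "J \<le> CARD('n)"
    and left_signs: "first_negative lam I (Uex xL)"
    and right_signs: "first_negative lam J (Uex xR)"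
    and free_components: "inj_on e (- {s})"
      "\<And>p i. p \<in> param_space s \<Longrightarrow> i \<noteq> s \<Longrightarrow> UL p $ e i = p $ i"
    and no_turning_points:
      "\<And>x i. x \<in> {xL..yex $ s} \<Longrightarrow> i \<in> {1..CARD('n)} \<Longrightarrow> lam i (Uex x) \<noteq> 0"
      "\<And>x i. x \<in> {yex $ s..xR} \<Longrightarrow> i \<in> {1..CARD('n)} \<Longrightarrow>
         lam i (right_part (yex $ s) Uex x) \<noteq> 0"
    and well_posed: "well_posed D f lam a xL xR s UL BR Phi yex Uex"
    and order: "k > 0"
    and consistent:
      "consistent_near (\<lambda>h (x, U). Ph h xL x U) (\<lambda>(x, U). evolution D f a xL x U)
         (yex $ s, Uex xL)"
      "consistent_near (\<lambda>h (x, U). Ph h x xR U) (\<lambda>(x, U). evolution D f a x xR U)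
         (yex $ s, Phi (Uex (yex $ s)))"
    and stable:
      "stable_near (\<lambda>h x U. Ph h xL x U) (yex $ s) (Uex xL)"
      "stable_near (\<lambda>h x U. Ph h x xR U) (yex $ s) (Phi (Uex (yex $ s)))"
    and lipschitz: "lipschitz_in_unknowns xL xR s UL Ph Phih yex"
    and accurate:
      "accurate_near k (\<lambda>h (x, U). Ph h xL x U) (\<lambda>(x, U). evolution D f a xL x U)
         (yex $ s, Uex xL)"
      "accurate_near k Phih Phi (Uex (yex $ s))"
      "accurate_near k (\<lambda>h (x, U). Ph h x xR U) (\<lambda>(x, U). evolution D f a x xR U)
         (yex $ s, Phi (Uex (yex $ s)))"
  shows "\<exists>Y C. open Y \<and> yex \<in> Y \<and>
           (\<forall>h>0. \<forall>y\<in>Y. residual xL xR s UL BR (Ph h) (Phih h) y = 0 \<longrightarrow>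
              norm (y - yex) \<le> C * h powr k)"
proof -
  let ?c = "yex $ s" and ?R = "right_part (yex $ s) Uex"
  have exact: "shock_solution D f lam a xL xR s UL BR 0 yex Uex"
    and stab: "L1_stable D f lam a xL xR s UL BR"
    and reg: "regular_along D f a xL xR {xL..?c} Uex" "regular_along D f a xL xR {?c..xR} ?R"
    and partner: "\<exists>!V. lax_shock D f lam (Uex ?c) V"
    and jump: "jump_operator_near D f lam Phi (Uex ?c)"
    and BR: "lipschitz_near UNIV BR (Uex xR)"
    using well_posed unfolding well_posed_def unique_shock_solution_def by auto
  have c: "xL < ?c" "?c < xR" and smooth: "smooth_solution D f a xL ?c Uex" "smooth_solution D f a ?c xR ?R"
    and lax: "lax_shock D f lam (Uex ?c) (?R ?c)"
    using exact unfolding shock_solution_def by auto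
  have "lax_shock D f lam (Uex ?c) (Phi (Uex ?c))"
    using jump unfolding jump_operator_near_def by blast
  then have jump_exact: "Phi (Uex ?c) = ?R ?c" using partner lax by blast
  interpret steady_system D f a xL xR
    using state_space hyperbolic by unfold_locales (auto simp: strictly_hyperbolic_def)
  obtain r1 K1 where 1: "r1 > 0" "K1 \<ge> 1" "\<And>x. x \<in> {xL..?c} \<Longrightarrow> local_bounds r1 K1 (Uex x) x"
  proof (rule local_bounds_uniform[OF smooth_solution_continuous[OF smooth(1)]])
    fix x assume x: "x \<in> {xL..?c}"
    then have "Uex x \<in> D" "x \<in> {xL..xR}" using smooth(1) c unfolding smooth_solution_def by auto
    moreover have "C11_diffeo_near f (Uex x)"
      "lipschitz_near (D \<times> {xL..xR}) (\<lambda>(V, t). a V t) (Uex x, x)"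
      using reg(1) x unfolding regular_along_def by blast+
    ultimately obtain r K where "r > 0" "local_bounds r K (Uex x) x"
      by (rule local_bounds_exists)
    then show "\<exists>r>0. \<exists>K. local_bounds r K (Uex x) x" by blast
  qed blast
  obtain r2 K2 where 2: "r2 > 0" "K2 \<ge> 1" "\<And>x. x \<in> {?c..xR} \<Longrightarrow> local_bounds r2 K2 (?R x) x"
  proof (rule local_bounds_uniform[OF smooth_solution_continuous[OF smooth(2)]])
    fix x assume x: "x \<in> {?c..xR}"
    then have "?R x \<in> D" "x \<in> {xL..xR}" using smooth(2) c unfolding smooth_solution_def by auto
    moreover have "C11_diffeo_near f (?R x)"
      "lipschitz_near (D \<times> {xL..xR}) (\<lambda>(V, t). a V t) (?R x, x)"
      using reg(2) x unfolding regular_along_def by blast+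
    ultimately obtain r K where "r > 0" "local_bounds r K (?R x) x"
      by (rule local_bounds_exists)
    then show "\<exists>r>0. \<exists>K. local_bounds r K (?R x) x" by blast
  qed blast
  interpret exact_shock D f a xL xR lam s e UL BR Phi yex Uex "min r1 r2" "max K1 K2"
  proof unfold_locales
    show "local_bounds (min r1 r2) (max K1 K2) (Uex x) x" if "x \<in> {xL..?c}" for x
      using 1(3)[OF that] by (rule local_bounds_mono) auto
    show "local_bounds (min r1 r2) (max K1 K2) (?R x) x" if "x \<in> {?c..xR}" for x
      using 2(3)[OF that] by (rule local_bounds_mono) auto
  qed (use exact 1 2 free_components(2) jump jump_exact in auto)
  have regc: "C11_diffeo_near f (Uex ?c)" "C11_diffeo_near f (?R ?c)"
    using reg c unfolding regular_along_def by auto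
  obtain \<rho> h0 C1 where \<rho>: "\<rho> > 0" "h0 > 0" "C1 \<ge> 0"
    and err: "\<And>h b y U. h \<in> {0<..h0} \<Longrightarrow> shock_solution D f lam a xL xR s UL BR b y U \<Longrightarrow>
       close_to_exact \<rho> y U \<Longrightarrow>
       norm (residual xL xR s UL BR (Ph h) (Phih h) y - b) \<le> C1 * h powr k"
    using discrete_residual_error[OF order hyperbolic regc BR stable(2) accurate] by metis
  have dim: "CARD('m) = CARD('j)" using dims by simp
  obtain Y C2 where Y: "open Y" "yex \<in> Y" "C2 \<ge> 0"
    and attained: "\<And>y. y \<in> Y \<Longrightarrow> \<exists>b U. shock_solution D f lam a xL xR s UL BR b y U \<and>
        close_to_exact \<rho> y U \<and> norm (y - yex) \<le> C2 * norm b"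
    using parameters_near_exact_are_attained[OF stab dim \<rho>(1)] by metis
  define C where "C = max (C2 * C1) (1 / h0 powr k)"
  show ?thesis
  proof (intro exI conjI allI impI ballI)
    show "open (Y \<inter> ball yex 1)" using Y(1) by (intro open_Int) auto
    show "yex \<in> Y \<inter> ball yex 1" using Y(2) by simp
    fix h y assume h: "h > 0" and y: "y \<in> Y \<inter> ball yex 1"
      and zero: "residual xL xR s UL BR (Ph h) (Phih h) y = 0"
    show "norm (y - yex) \<le> C * h powr k"
    proof (cases "h \<le> h0")
      case True
      obtain b U where b: "shock_solution D f lam a xL xR s UL BR b y U" "close_to_exact \<rho> y U"
          "norm (y - yex) \<le> C2 * norm b"
        using attained y by blast
      have "norm b \<le> C1 * h powr k" using err[OF _ b(1,2), of h] zero h True by simp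
      then have "C2 * norm b \<le> C2 * (C1 * h powr k)" using Y(3) by (rule mult_left_mono)
      also have "\<dots> \<le> C * h powr k"
        unfolding mult.assoc[symmetric] C_def by (intro mult_right_mono) auto
      finally show ?thesis using b(3) by linarith
    next
      case False
      \<comment> \<open>For coarse discretizations the bound only expresses that the neighbourhood is bounded.\<close>
      have "h0 powr k \<le> h powr k" using False \<rho>(2) order by (intro powr_mono2) auto
      then have "1 \<le> 1 / h0 powr k * h powr k" using \<rho>(2) by (simp add: pos_le_divide_eq)
      also have "\<dots> \<le> C * h powr k" unfolding C_def by (intro mult_right_mono) auto
      finally show ?thesis using y by (simp add: dist_norm norm_minus_commute)
    qed
  qed
qed

end
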